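(* For every positive integer $n$ there exists a staged assembly system with temperature $\tau=2$ that (uniquely) assembles a fully connected $n\times n$ square, using $\mathcal{O}(\log n)$ stages, $4$ glues, $14$ tile types and $7$ bins.
   Context: Staged tile assembly model (two-handed, staged). A tile is a non-rotatable unit square carrying on each of its four sides (north, east, south, west) a glue from a finite alphabet $\Sigma$ containing a special null glue. A glue function $G:\Sigma^2\to\{0,1,\dots,\tau\}$ is symmetric, with $G(\mathrm{null},x)=0$; $\tau$ is a positive integer, the temperature. The glue complexity is the number of non-null glues used, the tile complexity the number of distinct tile types. A supertile is a finite edge-connected set of tiles placed at positions of $\mathbb{Z}^2$. Two supertiles combine if they can be placed next to each other by translation only (no rotation, no overlap) such that the sum of $G$-values of the glue pairs on all newly coincident edges is at least $\tau$. A bin is a set of initial supertiles; its produced supertiles are the closure under combination, and its terminal supertiles are those produced supertiles that cannot combine with any produced supertile. A staged assembly system with $r$ stages and $b$ bins per stage: each bin of stage 1 receives a set of tile types; each bin of stage $i\ge 2$ receives the union of the terminal supertiles of some bins of stage $i-1$, plus possibly additional tile types; the output is the union of the terminal supertiles of selected bins of stage $r$. The system uniquely assembles a shape if the terminal supertiles in every bin are unique and the output is a single supertile of that shape. The stage complexity is $r$ and the bin complexity is $b$. A supertile is fully connected if every two (horizontally or vertically) adjacent tiles in it share a glue of positive strength on their common edge. *)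

theory Defs
  imports Complex_Main
begin

text \<open>Glues are natural numbers; glue 0 is the special null glue.
  A tile type is a quadruple of glues (north, east, south, west).
  Positions are points of Z^2; north means increasing second coordinate,
  east means increasing first coordinate.\<close>

type_synonym glue = nat
type_synonym tile = "glue \<times> glue \<times> glue \<times> glue"
type_synonym pos = "int \<times> int"
type_synonym supertile = "pos \<Rightarrow> tile option"

definition north :: "tile \<Rightarrow> glue" where "north t = fst t"
definition east  :: "tile \<Rightarrow> glue" where "east t = fst (snd t)"
definition south :: "tile \<Rightarrow> glue" where "south t = fst (snd (snd t))"
definition west  :: "tile \<Rightarrow> glue" where "west t = snd (snd (snd t))"

definition translate :: "pos \<Rightarrow> supertile \<Rightarrow> supertile" where
  "translate v A = (\<lambda>p. A (fst p - fst v, snd p - snd v))"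

definition contrib :: "(glue \<Rightarrow> glue \<Rightarrow> nat) \<Rightarrow> supertile \<Rightarrow> supertile \<Rightarrow> pos \<Rightarrow> nat" where
  "contrib G A B p =
     (case A p of None \<Rightarrow> 0 | Some t \<Rightarrow>
        (case B (fst p + 1, snd p) of None \<Rightarrow> 0 | Some u \<Rightarrow> G (east t) (west u))
      + (case B (fst p - 1, snd p) of None \<Rightarrow> 0 | Some u \<Rightarrow> G (west t) (east u))
      + (case B (fst p, snd p + 1) of None \<Rightarrow> 0 | Some u \<Rightarrow> G (north t) (south u))
      + (case B (fst p, snd p - 1) of None \<Rightarrow> 0 | Some u \<Rightarrow> G (south t) (north u)))"

definition bond :: "(glue \<Rightarrow> glue \<Rightarrow> nat) \<Rightarrow> supertile \<Rightarrow> supertile \<Rightarrow> nat" where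
  "bond G A B = (\<Sum>p\<in>dom A. contrib G A B p)"

definition single :: "tile \<Rightarrow> supertile" where
  "single t = [(0, 0) \<mapsto> t]"

text \<open>Produced supertiles of a bin (two-handed assembly); the set is
  closed under translation, so supertiles are considered up to translation.\<close>
inductive_set produced :: "(glue \<Rightarrow> glue \<Rightarrow> nat) \<Rightarrow> nat \<Rightarrow> supertile set \<Rightarrow> supertile set"
  for G :: "glue \<Rightarrow> glue \<Rightarrow> nat" and \<tau> :: nat and S :: "supertile set" where
  init: "A \<in> S \<Longrightarrow> A \<in> produced G \<tau> S"
| transl: "A \<in> produced G \<tau> S \<Longrightarrow> translate v A \<in> produced G \<tau> S"
| comb: "A \<in> produced G \<tau> S \<Longrightarrow> B \<in> produced G \<tau> S \<Longrightarrow> dom A \<inter> dom B = {}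
         \<Longrightarrow> bond G A B \<ge> \<tau> \<Longrightarrow> (A ++ B) \<in> produced G \<tau> S"

definition terminal :: "(glue \<Rightarrow> glue \<Rightarrow> nat) \<Rightarrow> nat \<Rightarrow> supertile set \<Rightarrow> supertile set" where
  "terminal G \<tau> S = {A \<in> produced G \<tau> S. \<forall>B \<in> produced G \<tau> S.
                         dom A \<inter> dom B = {} \<longrightarrow> bond G A B < \<tau>}"

text \<open>A staged system: stages 0..stages-1 (stage 0 is the paper's stage 1),
  bins 0..bins-1 in each stage. mixin i j = bins of stage i-1 whose terminal
  supertiles are poured into bin j of stage i; added i j = tile types added.\<close>
record staged =
  gluefun :: "glue \<Rightarrow> glue \<Rightarrow> nat"
  temp :: nat
  stages :: nat
  bins :: nat
  mixin :: "nat \<Rightarrow> nat \<Rightarrow> nat set"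
  added :: "nat \<Rightarrow> nat \<Rightarrow> tile set"
  outbins :: "nat set"

fun binterm :: "staged \<Rightarrow> nat \<Rightarrow> nat \<Rightarrow> supertile set" where
  "binterm sys 0 j = terminal (gluefun sys) (temp sys) (single ` added sys 0 j)"
| "binterm sys (Suc i) j = terminal (gluefun sys) (temp sys)
      ((\<Union>k \<in> mixin sys (Suc i) j \<inter> {..<bins sys}. binterm sys i k) \<union> single ` added sys (Suc i) j)"

definition well_formed :: "staged \<Rightarrow> bool" where
  "well_formed sys \<longleftrightarrow>
     temp sys \<ge> 1 \<and> stages sys \<ge> 1 \<and>
     (\<forall>x y. gluefun sys x y = gluefun sys y x) \<and>
     (\<forall>x. gluefun sys 0 x = 0) \<and>
     (\<forall>x y. gluefun sys x y \<le> temp sys) \<and>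
     (\<forall>j. mixin sys 0 j = {}) \<and>
     (\<forall>i j. mixin sys i j \<subseteq> {..<bins sys}) \<and>
     outbins sys \<subseteq> {..<bins sys}"

definition tile_types :: "staged \<Rightarrow> tile set" where
  "tile_types sys = (\<Union>i<stages sys. \<Union>j<bins sys. added sys i j)"

definition glues_used :: "staged \<Rightarrow> glue set" where
  "glues_used sys = {g. g \<noteq> 0 \<and> (\<exists>t \<in> tile_types sys. g \<in> {north t, east t, south t, west t})}"

definition out_supertiles :: "staged \<Rightarrow> supertile set" where
  "out_supertiles sys = (\<Union>j \<in> outbins sys. binterm sys (stages sys - 1) j)"

definition shifted :: "pos \<Rightarrow> pos set \<Rightarrow> pos set" where
  "shifted v X = {(fst p + fst v, snd p + snd v) | p. p \<in> X}"

definition uniquely_assembles :: "staged \<Rightarrow> pos set \<Rightarrow> bool" where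
  "uniquely_assembles sys X \<longleftrightarrow>
     (\<forall>i < stages sys. \<forall>j < bins sys. \<forall>A \<in> binterm sys i j. \<forall>B \<in> binterm sys i j.
         \<exists>v. B = translate v A) \<and>
     (\<exists>S \<in> out_supertiles sys. (\<forall>B \<in> out_supertiles sys. \<exists>v. B = translate v S) \<and>
         (\<exists>v. dom S = shifted v X))"

definition fully_connected :: "(glue \<Rightarrow> glue \<Rightarrow> nat) \<Rightarrow> supertile \<Rightarrow> bool" where
  "fully_connected G S \<longleftrightarrow>
     (\<forall>x y t u. S (x, y) = Some t \<and> S (x + 1, y) = Some u \<longrightarrow> G (east t) (west u) > 0) \<and>
     (\<forall>x y t u. S (x, y) = Some t \<and> S (x, y + 1) = Some u \<longrightarrow> G (north t) (south u) > 0)"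

definition square :: "nat \<Rightarrow> pos set" where
  "square n = {0..<int n} \<times> {0..<int n}"

end

theory Submission
  imports Defs
begin

text \<open>Lines of length \<open>n - 1\<close> are grown along the binary expansion of \<open>n - 1\<close>. The three strong glues
  are ordered cyclically, and three bins hold the lines of the current length from each glue to its
  successor. Joining consecutive lines doubles the length and reverses the cyclic order, as does
  appending one tile, so both steps preserve the situation with three bins, and a line never sticks
  to itself because its two end glues differ. Columns are mirror images of rows. A corner tile joins
  a row and a column to an L-shaped frame with weak glues on its two inner sides, and then a single
  filler tile, whose weak glues only hold where a west and a south neighbour are present, completes
  the frame to the square and cannot leave it.\<close>

section \<open>Bonds and translations\<close>

text \<open>The obstacle is uniqueness. Every bin of every stage must have one terminal supertile up
  to translation, so exhibiting an assembly is not enough: the whole produced set of each bin has to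
  be determined. With two strong glues, joining a line from \<open>a\<close> to \<open>b\<close>
  with one from \<open>b\<close> to \<open>a\<close> would give a line with equal ends, which grows
  without bound; a third glue allows \<open>a\<close>, \<open>b\<close>, \<open>c\<close> to be
  distinct at each join. The second obstacle is that partly filled frames must not stick to each
  other. This is why the weak glue sits on one side of each line only: the south side of rows and
  the west side of columns are null, so a frame shows nothing but null glues to the south and west,
  however far it is filled. Non-bonding is therefore mostly proved by comparing exposed glues, with
  total strength 0 rather than merely below 2; strength 1 matters only for fillers. Each binary
  digit costs at most two stages, and after the lines are complete three stages remain: corner,
  column, filling.\<close>

lemma translate_zero [simp]: "translate (0, 0) A = A"
  by (simp add: translate_def)

lemma translate_translate [simp]:
  "translate u (translate v A) = translate (fst u + fst v, snd u + snd v) A"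
  by (simp add: translate_def fun_eq_iff algebra_simps)

lemma translate_map_add: "translate v (A ++ B) = translate v A ++ translate v B"
  by (simp add: translate_def map_add_def fun_eq_iff)

lemma translate_apply: "translate v A (x, y) = A (x - fst v, y - snd v)"
  by (simp add: translate_def)

lemma dom_translate: "dom (translate v A) = (\<lambda>p. (fst p + fst v, snd p + snd v)) ` dom A"
proof -
  have "p \<in> dom (translate v A) \<Longrightarrow> p \<in> (\<lambda>p. (fst p + fst v, snd p + snd v)) ` dom A" for p
    by (rule image_eqI[of _ _ "(fst p - fst v, snd p - snd v)"]) (auto simp: translate_def dom_def)
  then show ?thesis
    by (auto simp: translate_def)
qed

lemma dom_translate_disjoint [simp]:
  "dom (translate v A) \<inter> dom (translate v B) = {} \<longleftrightarrow> dom A \<inter> dom B = {}"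
proof -
  have "inj (\<lambda>p. (fst p + fst v, snd p + snd v))"
    by (auto simp: inj_on_def prod_eq_iff)
  then show ?thesis
    unfolding dom_translate by (subst image_Int[symmetric]) auto
qed

lemma finite_dom_translate [simp]: "finite (dom (translate v A)) \<longleftrightarrow> finite (dom A)"
  unfolding dom_translate by (rule finite_image_iff) (auto simp: inj_on_def prod_eq_iff)

lemma bond_translate [simp]: "bond G (translate v A) (translate v B) = bond G A B"
proof -
  have shift: "a + b + 1 - b = a + 1" "a + b - 1 - b = a - 1" for a b :: int
    by simp_all
  have *: "contrib G (translate v A) (translate v B) (fst p + fst v, snd p + snd v) = contrib G A B p" for p
    by (simp only: contrib_def translate_def fst_conv snd_conv shift add_diff_cancel_right' prod.collapse)
  show ?thesis
    unfolding bond_def dom_translate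
    by (subst sum.reindex) (auto simp: inj_on_def prod_eq_iff *)
qed

text \<open>Each common edge is counted once from the side of \<open>A\<close> and once, in the
  opposite direction, from the side of \<open>B\<close>. Finiteness matters because a sum over an
  infinite set is 0 by convention.\<close>

lemma bond_commute:
  assumes sym: "\<And>g h. G g h = G h g" and fin: "finite (dom A)" "finite (dom B)"
  shows "bond G A B = bond G B A"
proof -
  define T where "T f g d A B p = (case A p of None \<Rightarrow> 0 | Some t \<Rightarrow>
      (case B (fst p + fst d, snd p + snd d) of None \<Rightarrow> 0 | Some u \<Rightarrow> G (f t) (g u)))"
    for f g :: "tile \<Rightarrow> glue" and d :: pos and A B :: supertile and p
  \<comment> \<open>Shifting by \<open>d\<close> does not map \<open>dom A\<close> onto
    \<open>dom B\<close>; it only matches positions with nonzero terms, hence the reindexing rule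
    with exceptional sets of zero terms.\<close>
  have swap: "(\<Sum>p\<in>dom A. T f g d A B p) = (\<Sum>q\<in>dom B. T g f (- fst d, - snd d) B A q)" for f g d
    by (rule sum.reindex_bij_witness_not_neutral
          [where S' = "{p \<in> dom A. T f g d A B p = 0}"
            and T' = "{q \<in> dom B. T g f (- fst d, - snd d) B A q = 0}"
            and i = "\<lambda>q. (fst q - fst d, snd q - snd d)"
            and j = "\<lambda>p. (fst p + fst d, snd p + snd d)"])
       (auto simp: T_def fin sym split: option.splits)
  have contrib: "contrib G A B p = T east west (1, 0) A B p + T west east (-1, 0) A B p
      + T north south (0, 1) A B p + T south north (0, -1) A B p" for A B p
    by (auto simp: contrib_def T_def split: option.splits)
  show ?thesis
    unfolding bond_def contrib sum.distrib
    using swap[of east west "(1, 0)"] swap[of west east "(-1, 0)"]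
      swap[of north south "(0, 1)"] swap[of south north "(0, -1)"] by simp
qed

lemma contrib_le_bond: "finite (dom A) \<Longrightarrow> p \<in> dom A \<Longrightarrow> contrib G A B p \<le> bond G A B"
  unfolding bond_def by (rule member_le_sum) auto

text \<open>Disjointness becomes emptiness of the opposite cells: a bonding edge lies between two
  faces that are each exposed in their own supertile. This reduces bonds to exposed glues.\<close>

lemma bond_pos_cases:
  assumes "dom A \<inter> dom B = {}" "bond G A B > 0"
  obtains
    (E) x y t u where "A (x, y) = Some t" "B (x + 1, y) = Some u" "A (x + 1, y) = None" "B (x, y) = None"
      "G (east t) (west u) > 0"
  | (W) x y t u where "A (x, y) = Some t" "B (x - 1, y) = Some u" "A (x - 1, y) = None" "B (x, y) = None"
      "G (west t) (east u) > 0"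
  | (N) x y t u where "A (x, y) = Some t" "B (x, y + 1) = Some u" "A (x, y + 1) = None" "B (x, y) = None"
      "G (north t) (south u) > 0"
  | (S) x y t u where "A (x, y) = Some t" "B (x, y - 1) = Some u" "A (x, y - 1) = None" "B (x, y) = None"
      "G (south t) (north u) > 0"
proof -
  from assms(2) obtain x y where p: "(x, y) \<in> dom A" "contrib G A B (x, y) > 0"
    unfolding bond_def by (metis less_numeral_extra(3) neq0_conv prod.exhaust_sel sum.neutral)
  have disj: "A q = None \<or> B q = None" for q
    using assms(1) by (metis disjoint_iff domIff)
  from p show thesis
    using disj[of "(x, y)"] disj[of "(x + 1, y)"] disj[of "(x - 1, y)"] disj[of "(x, y + 1)"] disj[of "(x, y - 1)"]
    by (auto simp: contrib_def split: option.splits if_splits intro: that)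
qed

text \<open>Glues on faces whose neighbouring cell is empty: only these can take part in a bond with
  a disjoint supertile.\<close>

definition exposed_north :: "supertile \<Rightarrow> glue set" where
  "exposed_north A = {north t | t x y. A (x, y) = Some t \<and> A (x, y + 1) = None}"
definition exposed_east :: "supertile \<Rightarrow> glue set" where
  "exposed_east A = {east t | t x y. A (x, y) = Some t \<and> A (x + 1, y) = None}"
definition exposed_south :: "supertile \<Rightarrow> glue set" where
  "exposed_south A = {south t | t x y. A (x, y) = Some t \<and> A (x, y - 1) = None}"
definition exposed_west :: "supertile \<Rightarrow> glue set" where
  "exposed_west A = {west t | t x y. A (x, y) = Some t \<and> A (x - 1, y) = None}"

lemma exposedI:
  "A (x, y) = Some t \<Longrightarrow> A (x, y + 1) = None \<Longrightarrow> north t \<in> exposed_north A"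
  "A (x, y) = Some t \<Longrightarrow> A (x + 1, y) = None \<Longrightarrow> east t \<in> exposed_east A"
  "A (x, y) = Some t \<Longrightarrow> A (x, y - 1) = None \<Longrightarrow> south t \<in> exposed_south A"
  "A (x, y) = Some t \<Longrightarrow> A (x - 1, y) = None \<Longrightarrow> west t \<in> exposed_west A"
  unfolding exposed_north_def exposed_east_def exposed_south_def exposed_west_def by blast+

lemma exposed_subsetI:
  "(\<And>x y t. A (x, y) = Some t \<Longrightarrow> A (x, y + 1) = None \<Longrightarrow> north t \<in> X) \<Longrightarrow> exposed_north A \<subseteq> X"
  "(\<And>x y t. A (x, y) = Some t \<Longrightarrow> A (x + 1, y) = None \<Longrightarrow> east t \<in> X) \<Longrightarrow> exposed_east A \<subseteq> X"
  "(\<And>x y t. A (x, y) = Some t \<Longrightarrow> A (x, y - 1) = None \<Longrightarrow> south t \<in> X) \<Longrightarrow> exposed_south A \<subseteq> X"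
  "(\<And>x y t. A (x, y) = Some t \<Longrightarrow> A (x - 1, y) = None \<Longrightarrow> west t \<in> X) \<Longrightarrow> exposed_west A \<subseteq> X"
  unfolding exposed_north_def exposed_east_def exposed_south_def exposed_west_def by blast+

lemma exposed_translate_subset:
  "exposed_north (translate v A) \<subseteq> exposed_north A" "exposed_east (translate v A) \<subseteq> exposed_east A"
  "exposed_south (translate v A) \<subseteq> exposed_south A" "exposed_west (translate v A) \<subseteq> exposed_west A"
proof -
  have shift: "a + 1 - b = a - b + 1" "a - 1 - b = a - b - 1" for a b :: int
    by simp_all
  show "exposed_north (translate v A) \<subseteq> exposed_north A" "exposed_east (translate v A) \<subseteq> exposed_east A"
    "exposed_south (translate v A) \<subseteq> exposed_south A" "exposed_west (translate v A) \<subseteq> exposed_west A"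
    unfolding exposed_north_def exposed_east_def exposed_south_def exposed_west_def translate_apply shift
    by blast+
qed

text \<open>Only \<open>B\<close> is moved: shifting both supertiles together changes neither
  disjointness nor bond, so only the relative displacement counts.\<close>

definition attaches :: "(glue \<Rightarrow> glue \<Rightarrow> nat) \<Rightarrow> nat \<Rightarrow> supertile \<Rightarrow> supertile \<Rightarrow> bool" where
  "attaches G \<tau> A B \<longleftrightarrow> (\<exists>v. dom A \<inter> dom (translate v B) = {} \<and> \<tau> \<le> bond G A (translate v B))"

text \<open>The criterion rules out even a single bonding edge, so the temperature enters only
  through positivity. This is strong enough for all inert pairs below that do not involve a lone
  filler.\<close>

lemma not_attaches:
  assumes "\<tau> > 0"
    and "\<And>g h. g \<in> exposed_north A \<Longrightarrow> h \<in> exposed_south B \<Longrightarrow> G g h = 0"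
    and "\<And>g h. g \<in> exposed_east A \<Longrightarrow> h \<in> exposed_west B \<Longrightarrow> G g h = 0"
    and "\<And>g h. g \<in> exposed_south A \<Longrightarrow> h \<in> exposed_north B \<Longrightarrow> G g h = 0"
    and "\<And>g h. g \<in> exposed_west A \<Longrightarrow> h \<in> exposed_east B \<Longrightarrow> G g h = 0"
  shows "\<not> attaches G \<tau> A B"
proof
  assume "attaches G \<tau> A B"
  then obtain v where v: "dom A \<inter> dom (translate v B) = {}" "bond G A (translate v B) > 0"
    using assms(1) by (auto simp: attaches_def)
  from v show False
  proof (cases rule: bond_pos_cases)
    case (E x y t u)
    then have "east t \<in> exposed_east A" "west u \<in> exposed_west (translate v B)"
      using exposedI(2)[of A x y t] exposedI(4)[of "translate v B" "x + 1" y u] by simp_all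
    then have "east t \<in> exposed_east A" "west u \<in> exposed_west B"
      using exposed_translate_subset by blast+
    with E assms(3) show False by fastforce
  next
    case (W x y t u)
    then have "west t \<in> exposed_west A" "east u \<in> exposed_east (translate v B)"
      using exposedI(4)[of A x y t] exposedI(2)[of "translate v B" "x - 1" y u] by simp_all
    then have "west t \<in> exposed_west A" "east u \<in> exposed_east B"
      using exposed_translate_subset by blast+
    with W assms(5) show False by fastforce
  next
    case (N x y t u)
    then have "north t \<in> exposed_north A" "south u \<in> exposed_south (translate v B)"
      using exposedI(1)[of A x y t] exposedI(3)[of "translate v B" x "y + 1" u] by simp_all
    then have "north t \<in> exposed_north A" "south u \<in> exposed_south B"
      using exposed_translate_subset by blast+
    with N assms(2) show False by fastforce
  next
    case (S x y t u)
    then have "south t \<in> exposed_south A" "north u \<in> exposed_north (translate v B)"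
      using exposedI(3)[of A x y t] exposedI(1)[of "translate v B" x "y - 1" u] by simp_all
    then have "south t \<in> exposed_south A" "north u \<in> exposed_north B"
      using exposed_translate_subset by blast+
    with S assms(4) show False by fastforce
  qed
qed

section \<open>Bins whose contents are known up to translation\<close>

definition orbit :: "supertile \<Rightarrow> supertile set" where
  "orbit A = range (\<lambda>v. translate v A)"

lemma orbit_self [simp]: "A \<in> orbit A"
  unfolding orbit_def by (metis rangeI translate_zero)

lemma orbit_nonempty [simp]: "orbit A \<noteq> {}"
  by (simp add: orbit_def)

lemma translate_in_orbit [simp]: "translate v A \<in> orbit A"
  by (simp add: orbit_def)

lemma orbit_translate: "B \<in> orbit A \<Longrightarrow> translate v B \<in> orbit A"
  by (metis orbit_def rangeE translate_in_orbit translate_translate)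

lemma orbit_related: "B \<in> orbit A \<Longrightarrow> C \<in> orbit A \<Longrightarrow> \<exists>v. C = translate v B"
proof -
  assume "B \<in> orbit A" "C \<in> orbit A"
  then obtain u w where "B = translate u A" "C = translate w A" by (auto simp: orbit_def)
  then have "C = translate (fst w - fst u, snd w - snd u) B" by simp
  then show ?thesis ..
qed

lemma attachesI:
  assumes "X \<in> orbit A" "Y \<in> orbit B" "dom X \<inter> dom Y = {}" "\<tau> \<le> bond G X Y"
  obtains u v where "X = translate u A" "Y = translate u (translate v B)"
    "dom A \<inter> dom (translate v B) = {}" "\<tau> \<le> bond G A (translate v B)"
proof -
  obtain u w where uw: "X = translate u A" "Y = translate w B" using assms by (auto simp: orbit_def)
  define v where "v = (fst w - fst u, snd w - snd u)"
  have "Y = translate u (translate v B)" using uw by (simp add: v_def)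
  then show thesis using that uw(1) assms(3,4) dom_translate_disjoint bond_translate by metis
qed

lemma attaches_if_orbit:
  assumes "X \<in> orbit A" "Y \<in> orbit B" "dom X \<inter> dom Y = {}" "\<tau> \<le> bond G X Y"
  shows "attaches G \<tau> A B"
  using assms by (rule attachesI) (auto simp: attaches_def)

lemma produced_meets_orbit:
  "S \<inter> orbit A \<noteq> {} \<Longrightarrow> orbit A \<subseteq> produced G \<tau> S"
proof
  fix X assume "S \<inter> orbit A \<noteq> {}" "X \<in> orbit A"
  then obtain B v where "B \<in> S" "X = translate v B"
    using orbit_related by blast
  then show "X \<in> produced G \<tau> S"
    by (simp add: produced.init produced.transl)
qed

section \<open>Terminal supertiles of bins with one or two kinds of supertile\<close>

locale glue_function =
  fixes G :: "glue \<Rightarrow> glue \<Rightarrow> nat"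
  assumes commute: "G g h = G h g" and null [simp]: "G 0 g = 0"
begin

lemma null' [simp]: "G g 0 = 0"
  using commute[of g 0] by simp

lemma attaches_commute:
  assumes "finite (dom A)" "finite (dom B)" "attaches G \<tau> A B"
  shows "attaches G \<tau> B A"
proof -
  obtain v where v: "dom A \<inter> dom (translate v B) = {}" "\<tau> \<le> bond G A (translate v B)"
    using assms(3) by (auto simp: attaches_def)
  let ?w = "(- fst v, - snd v)"
  have "dom (translate ?w A) \<inter> dom (translate ?w (translate v B)) = {}"
    "\<tau> \<le> bond G (translate ?w A) (translate ?w (translate v B))"
    using v by (simp_all only: dom_translate_disjoint bond_translate)
  then have "dom B \<inter> dom (translate ?w A) = {}" "\<tau> \<le> bond G B (translate ?w A)"
    using bond_commute[of G "translate ?w A" B] commute assms by (auto simp: Int_commute)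
  then show ?thesis unfolding attaches_def by blast
qed

text \<open>One translate in \<open>S\<close> suffices because production is closed under
  translation; this covers freshly added tiles as well as supertiles poured in from an earlier
  bin.\<close>

lemma terminal_single:
  assumes "S \<subseteq> orbit A" "S \<noteq> {}" and inert: "\<not> attaches G \<tau> A A"
  shows "terminal G \<tau> S = orbit A"
proof -
  have no: False if "X \<in> orbit A" "Y \<in> orbit A" "dom X \<inter> dom Y = {}" "\<tau> \<le> bond G X Y" for X Y
    using that inert attaches_if_orbit by blast
  have "X \<in> orbit A" if "X \<in> produced G \<tau> S" for X
    using that
  proof induction
    case (comb X Y)
    then show ?case using no by blast
  qed (use assms orbit_translate in auto)
  moreover have "orbit A \<subseteq> produced G \<tau> S"
    using produced_meets_orbit assms(1,2) by blast
  ultimately have "produced G \<tau> S = orbit A" by blast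
  then show ?thesis
    unfolding terminal_def using no by (auto simp: not_less[symmetric] simp del: not_less)
qed

text \<open>The orbits of \<open>A\<close>, \<open>B\<close> and \<open>C\<close> are closed under
  combination: by \<open>unique\<close> the parts meet in one relative position only, and every
  other pair is inert. Each part has the other as partner and is not terminal, so only
  \<open>C\<close> survives. Doubling, appending and joining at the corner are all
  instances.\<close>

lemma terminal_pair:
  assumes S: "S \<subseteq> orbit A \<union> orbit B" "S \<inter> orbit A \<noteq> {}" "S \<inter> orbit B \<noteq> {}"
    and fin: "finite (dom A)" "finite (dom B)"
    and fit: "dom A \<inter> dom (translate v B) = {}" "\<tau> \<le> bond G A (translate v B)"
      "C = A ++ translate v B"
    and unique: "\<And>w. dom A \<inter> dom (translate w B) = {} \<Longrightarrow> \<tau> \<le> bond G A (translate w B) \<Longrightarrow> w = v"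
    and inert: "\<not> attaches G \<tau> A A" "\<not> attaches G \<tau> B B" "\<not> attaches G \<tau> C C"
      "\<not> attaches G \<tau> A C" "\<not> attaches G \<tau> B C"
  shows "terminal G \<tau> S = orbit C"
proof -
  let ?K = "orbit A \<union> orbit B \<union> orbit C"
  have finC: "finite (dom C)" using fin by (simp add: fit(3))
  have inert': "\<not> attaches G \<tau> C A" "\<not> attaches G \<tau> C B"
    using inert attaches_commute fin finC by blast+
  have AB: "X ++ Y \<in> orbit C" if "X \<in> orbit A" "Y \<in> orbit B" "dom X \<inter> dom Y = {}" "\<tau> \<le> bond G X Y" for X Y
    using that(1,2,3,4)
  proof (rule attachesI)
    fix u w assume *: "X = translate u A" "Y = translate u (translate w B)"
      "dom A \<inter> dom (translate w B) = {}" "\<tau> \<le> bond G A (translate w B)"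
    with unique have "w = v" by blast
    then show "X ++ Y \<in> orbit C"
      using *(1,2) translate_in_orbit[of u C] by (simp only: fit(3) translate_map_add)
  qed
  have no: "\<not> attaches G \<tau> P Q \<Longrightarrow> X \<in> orbit P \<Longrightarrow> Y \<in> orbit Q \<Longrightarrow> dom X \<inter> dom Y = {} \<Longrightarrow> \<tau> \<le> bond G X Y \<Longrightarrow> False"
    for P Q X Y
    using attaches_if_orbit by blast
  have BA: "X ++ Y \<in> orbit C" if "X \<in> orbit B" "Y \<in> orbit A" "dom X \<inter> dom Y = {}" "\<tau> \<le> bond G X Y" for X Y
  proof -
    have "finite (dom X)" "finite (dom Y)" using that fin by (auto simp: orbit_def)
    then have "\<tau> \<le> bond G Y X" using that(4) bond_commute[of G X Y] commute by simp
    then have "Y ++ X \<in> orbit C" using AB that by blast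
    then show ?thesis using map_add_comm[OF that(3)] by metis
  qed
  have sub: "X \<in> ?K" if "X \<in> produced G \<tau> S" for X
    using that
  proof induction
    case (comb X Y)
    have "\<not> (X \<in> orbit P \<and> Y \<in> orbit Q)" if "\<not> attaches G \<tau> P Q" for P Q
      using no[OF that] comb.hyps by metis
    from this[OF inert(1)] this[OF inert(2)] this[OF inert(3)] this[OF inert(4)] this[OF inert(5)]
      this[OF inert'(1)] this[OF inert'(2)]
    consider "X \<in> orbit A" "Y \<in> orbit B" | "X \<in> orbit B" "Y \<in> orbit A"
      using comb.IH by (metis UnE)
    then have "X ++ Y \<in> orbit C"
      using AB BA comb.hyps by (cases; metis)
    then show ?case by simp
  next
    case (init X)
    then show ?case using S(1) by blast
  next
    case (transl X u)
    then show ?case using orbit_translate[of X _ u] by blast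
  qed
  have prodAB: "orbit A \<subseteq> produced G \<tau> S" "orbit B \<subseteq> produced G \<tau> S"
    using S produced_meets_orbit by blast+
  have "C \<in> produced G \<tau> S"
    unfolding fit(3) using prodAB fit by (intro produced.comb) auto
  then have prodC: "orbit C \<subseteq> produced G \<tau> S"
    by (auto simp: orbit_def produced.transl)
  have notA: "X \<notin> terminal G \<tau> S" if X: "X \<in> orbit A" for X
  proof -
    obtain u where u: "X = translate u A" using X by (auto simp: orbit_def)
    have "translate u (translate v B) \<in> produced G \<tau> S"
      using prodAB by (auto simp: orbit_def)
    moreover have "dom X \<inter> dom (translate u (translate v B)) = {}" "\<tau> \<le> bond G X (translate u (translate v B))"
      using fit(1,2) unfolding u dom_translate_disjoint bond_translate by auto
    ultimately show ?thesis unfolding terminal_def by (auto simp: not_less)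
  qed
  have notB: "X \<notin> terminal G \<tau> S" if X: "X \<in> orbit B" for X
  proof -
    obtain u where u: "X = translate u (translate v B)"
      using X orbit_related[of "translate v B" B X] by auto
    have "translate u A \<in> produced G \<tau> S"
      using prodAB by (auto simp: orbit_def)
    moreover have "dom (translate u A) \<inter> dom X = {}" "\<tau> \<le> bond G (translate u A) X"
      using fit(1,2) unfolding u dom_translate_disjoint bond_translate by auto
    moreover have "bond G (translate u A) X = bond G X (translate u A)"
      using fin u by (intro bond_commute commute) auto
    ultimately show ?thesis unfolding terminal_def by (fastforce simp: not_less)
  qed
  have "X \<in> terminal G \<tau> S" if X: "X \<in> orbit C" for X
  proof -
    have "bond G X Y < \<tau>" if Y: "Y \<in> produced G \<tau> S" "dom X \<inter> dom Y = {}" for Y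
      using sub[OF Y(1)] no[OF inert(3) X _ Y(2)] no[OF inert'(1) X _ Y(2)] no[OF inert'(2) X _ Y(2)]
      by (metis UnE not_less)
    then show ?thesis using prodC X by (auto simp: terminal_def)
  qed
  moreover have "terminal G \<tau> S \<subseteq> ?K"
    using sub by (auto simp: terminal_def)
  ultimately show ?thesis using notA notB by blast
qed

end

section \<open>Reflection in the diagonal\<close>

definition flip_tile :: "tile \<Rightarrow> tile" where
  "flip_tile t = (east t, north t, west t, south t)"

definition flip :: "supertile \<Rightarrow> supertile" where
  "flip A = (\<lambda>p. map_option flip_tile (A (snd p, fst p)))"

lemma flip_tile_sides [simp]:
  "north (flip_tile t) = east t" "east (flip_tile t) = north t"
  "south (flip_tile t) = west t" "west (flip_tile t) = south t"
  by (simp_all add: flip_tile_def north_def east_def south_def west_def)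

lemma flip_tile_flip_tile [simp]: "flip_tile (flip_tile t) = t"
  by (simp add: flip_tile_def north_def east_def south_def west_def)

lemma flip_flip [simp]: "flip (flip A) = A"
  by (simp add: flip_def fun_eq_iff option.map_comp comp_def option.map_ident)

lemma flip_apply: "flip A (x, y) = map_option flip_tile (A (y, x))"
  by (simp add: flip_def)

lemma flip_translate: "flip (translate v A) = translate (snd v, fst v) (flip A)"
  by (simp add: flip_def translate_def)

lemma flip_map_add: "flip (A ++ B) = flip A ++ flip B"
  by (auto simp: flip_def map_add_def fun_eq_iff split: option.splits)

lemma flip_single: "flip (single t) = single (flip_tile t)"
  by (auto simp: flip_def single_def fun_eq_iff)

lemma dom_flip: "dom (flip A) = prod.swap ` dom A"
proof -
  have "p \<in> dom (flip A) \<Longrightarrow> p \<in> prod.swap ` dom A" for p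
    by (rule image_eqI[of _ _ "prod.swap p"]) (auto simp: flip_def prod.swap_def)
  then show ?thesis by (auto simp: flip_def)
qed

lemma finite_dom_flip [simp]: "finite (dom (flip A)) = finite (dom A)"
  by (simp add: dom_flip finite_image_iff)

lemma dom_flip_disjoint [simp]: "dom (flip A) \<inter> dom (flip B) = {} \<longleftrightarrow> dom A \<inter> dom B = {}"
  unfolding dom_flip by (subst image_Int[symmetric]) auto

lemma bond_flip [simp]: "bond G (flip A) (flip B) = bond G A B"
proof -
  have *: "contrib G (flip A) (flip B) (prod.swap p) = contrib G A B p" for p
    by (cases p) (auto simp: contrib_def flip_def split: option.splits)
  show ?thesis
    unfolding bond_def dom_flip by (subst sum.reindex) (auto simp: *)
qed

lemma orbit_flip: "orbit (flip A) = flip ` orbit A"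
proof -
  have "translate v (flip A) \<in> flip ` orbit A" for v
    by (rule image_eqI[of _ _ "translate (snd v, fst v) A"]) (simp_all add: flip_translate)
  then show ?thesis by (auto simp: orbit_def flip_translate)
qed

text \<open>Reflection preserves disjointness, bonds and unions and turns translations into
  translations, which gives one inclusion by induction; the other follows because
  \<open>flip\<close> is an involution.\<close>

lemma produced_flip: "produced G \<tau> (flip ` S) = flip ` produced G \<tau> S"
proof -
  have *: "flip A \<in> produced G \<tau> (flip ` S)" if "A \<in> produced G \<tau> S" for A S
    using that
  proof induction
    case (comb A B)
    then show ?case by (simp add: flip_map_add produced.comb)
  qed (auto simp: flip_translate intro: produced.intros)
  have "A \<in> flip ` produced G \<tau> S" if "A \<in> produced G \<tau> (flip ` S)" for A
    using *[OF that] by (intro image_eqI[of _ _ "flip A"]) (auto simp: image_image)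
  then show ?thesis using * by blast
qed

lemma terminal_flip: "terminal G \<tau> (flip ` S) = flip ` terminal G \<tau> S"
  unfolding terminal_def produced_flip by auto

section \<open>Straight lines of tiles\<close>

text \<open>Glues 1, 2, 3 are strong and hold the lines together; glue 4 is weak, so a tile held by it
  needs two neighbours.\<close>

definition strength :: "glue \<Rightarrow> glue \<Rightarrow> nat" where
  "strength g h = (if g = h \<and> g \<in> {1, 2, 3} then 2 else if g = 4 \<and> h = 4 then 1 else 0)"

interpretation strength: glue_function strength
  by unfold_locales (auto simp: strength_def)

text \<open>\<open>strength\<close> vanishes off the diagonal, so a bonding pair would be a common
  non-null glue.\<close>

lemma strength_disjoint:
  assumes "X \<inter> Y \<subseteq> {0}" "g \<in> X" "h \<in> Y" shows "strength g h = 0"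
  using assms by (cases "g = h") (auto simp: strength_def)

lemma strength_neq: "g \<noteq> h \<Longrightarrow> strength g h = 0"
  by (simp add: strength_def)

definition line :: "tile list \<Rightarrow> supertile" where
  "line ts = (\<lambda>p. if snd p = 0 \<and> 0 \<le> fst p \<and> fst p < int (length ts) then Some (ts ! nat (fst p)) else None)"

lemma line_apply:
  "line ts (x, y) = (if y = 0 \<and> 0 \<le> x \<and> x < int (length ts) then Some (ts ! nat x) else None)"
  by (simp add: line_def)

lemma line_Some: "line ts (x, y) = Some t \<longleftrightarrow> y = 0 \<and> 0 \<le> x \<and> x < int (length ts) \<and> t = ts ! nat x"
  by (auto simp: line_apply)

lemma line_None: "line ts (x, y) = None \<longleftrightarrow> y \<noteq> 0 \<or> x < 0 \<or> int (length ts) \<le> x"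
  by (auto simp: line_apply)

lemma finite_dom_line [simp]: "finite (dom (line ts))"
  by (rule finite_subset[of _ "{0..int (length ts)} \<times> {0}"]) (auto simp: line_Some dom_def)

lemma single_eq_line: "single t = line [t]"
  by (auto simp: single_def line_def fun_eq_iff)

lemma line_append: "line (xs @ ys) = line xs ++ translate (int (length xs), 0) (line ys)"
  by (auto simp: line_def fun_eq_iff map_add_def translate_def nth_append nat_less_iff nat_diff_distrib
      split: option.splits)

lemma line_first:
  assumes "line ts (x, y) = Some t" "line ts (x - 1, y) = None"
  shows "x = 0" "y = 0" "t = hd ts"
  using assms by (auto simp: line_Some line_None intro!: hd_conv_nth[symmetric])

lemma line_last:
  assumes "line ts (x, y) = Some t" "line ts (x + 1, y) = None"
  shows "x = int (length ts) - 1" "y = 0" "t = last ts"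
proof -
  show x: "x = int (length ts) - 1" "y = 0"
    using assms by (auto simp: line_Some line_None)
  then have "nat x = length ts - 1" "ts \<noteq> []"
    using assms(1) by (auto simp: line_Some)
  then show "t = last ts"
    using assms(1) by (simp add: line_Some last_conv_nth)
qed

lemma line_tile: "line ts (x, y) = Some t \<Longrightarrow> t \<in> set ts"
  by (auto simp: line_Some)

lemma exposed_line:
  "exposed_west (line ts) \<subseteq> {west (hd ts)}" "exposed_east (line ts) \<subseteq> {east (last ts)}"
  by (auto simp: exposed_west_def exposed_east_def dest: line_first line_last)

lemma exposed_south_line: "\<forall>t\<in>set ts. south t = 0 \<Longrightarrow> exposed_south (line ts) \<subseteq> {0}"
  by (auto simp: exposed_south_def dest: line_tile)

text \<open>Horizontally a line exposes only the outer glues of its end tiles, and null south faces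
  exclude vertical bonds; only the two end-to-end contacts have to be ruled out.\<close>

lemma lines_not_attach:
  assumes "\<forall>t\<in>set xs. south t = 0" "\<forall>t\<in>set ys. south t = 0"
    "east (last xs) \<noteq> west (hd ys)" "east (last ys) \<noteq> west (hd xs)"
  shows "\<not> attaches strength 2 (line xs) (line ys)"
proof (rule not_attaches)
  show "strength g h = 0" if "g \<in> exposed_east (line xs)" "h \<in> exposed_west (line ys)" for g h
    using that exposed_line assms by (intro strength_neq) blast
  show "strength g h = 0" if "g \<in> exposed_west (line xs)" "h \<in> exposed_east (line ys)" for g h
    using that exposed_line assms by (intro strength_neq) blast
  show "strength g h = 0" if "g \<in> exposed_north (line xs)" "h \<in> exposed_south (line ys)" for g h
    using that exposed_south_line[OF assms(2)] by auto
  show "strength g h = 0" if "g \<in> exposed_south (line xs)" "h \<in> exposed_north (line ys)" for g h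
    using that exposed_south_line[OF assms(1)] by auto
qed simp

text \<open>The hypotheses speak of end glues and south faces instead of \<open>row\<close>, so that
  the corner tile, with its null west and strong north glue, can take the place of
  \<open>xs\<close>.\<close>

lemma terminal_lines:
  assumes S: "S \<subseteq> orbit (line xs) \<union> orbit (line ys)" "S \<inter> orbit (line xs) \<noteq> {}" "S \<inter> orbit (line ys) \<noteq> {}"
    and ne: "xs \<noteq> []" "ys \<noteq> []"
    and south: "\<forall>t\<in>set xs \<union> set ys. south t = 0"
    and ends: "east (last xs) = west (hd ys)" "east (last xs) \<in> {1, 2, 3}"
      "west (hd xs) \<noteq> east (last xs)" "east (last ys) \<noteq> west (hd ys)" "east (last ys) \<noteq> west (hd xs)"
  shows "terminal strength 2 S = orbit (line (xs @ ys))"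
proof (rule strength.terminal_pair[OF S])
  let ?v = "(int (length xs), 0)"
  show "line (xs @ ys) = line xs ++ translate ?v (line ys)"
    by (rule line_append)
  show "dom (line xs) \<inter> dom (translate ?v (line ys)) = {}"
    by (auto simp: dom_def line_def translate_def split: if_splits)
  have l: "line xs (int (length xs) - 1, 0) = Some (last xs)"
    using ne by (cases "length xs") (auto simp: line_Some last_conv_nth nat_diff_distrib)
  have f: "translate ?v (line ys) (int (length xs), 0) = Some (hd ys)"
    using ne by (auto simp: translate_def line_Some hd_conv_nth)
  have "2 \<le> contrib strength (line xs) (translate ?v (line ys)) (int (length xs) - 1, 0)"
    using l f ends by (simp add: contrib_def strength_def)
  then show "2 \<le> bond strength (line xs) (translate ?v (line ys))"
    using contrib_le_bond[OF finite_dom_line, of "(int (length xs) - 1, 0)" xs] l order_trans by blast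
  \<comment> \<open>Vertical contacts die with the null south faces and the westward contact has
    unequal glues, which leaves \<open>ys\<close> directly to the right of
    \<open>xs\<close>.\<close>
  show "w = ?v" if w: "dom (line xs) \<inter> dom (translate w (line ys)) = {}"
    "2 \<le> bond strength (line xs) (translate w (line ys))" for w
  proof -
    have "0 < bond strength (line xs) (translate w (line ys))" using w by simp
    from w(1) this show ?thesis
    proof (cases rule: bond_pos_cases)
      case (E x y t u)
      have "line ys (x + 1 - fst w, y - snd w) = Some u" "line ys (x + 1 - fst w - 1, y - snd w) = None"
        using E by (simp_all add: translate_apply algebra_simps)
      with line_first[OF this] line_last[OF E(1,3)] show ?thesis by (simp add: prod_eq_iff)
    next
      case (W x y t u)
      have *: "line ys (x - 1 - fst w, y - snd w) = Some u" "line ys (x - 1 - fst w + 1, y - snd w) = None"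
        using W by (simp_all add: translate_apply algebra_simps)
      have "t = hd xs" "u = last ys" using line_last[OF *] line_first[OF W(1,3)] by auto
      then show ?thesis using W(5) ends by (simp add: strength_neq)
    next
      case (N x y t u)
      then have "u \<in> set ys" by (auto simp: translate_apply dest: line_tile)
      then show ?thesis using N(5) south by simp
    next
      case (S x y t u)
      then have "t \<in> set xs" by (auto dest: line_tile)
      then show ?thesis using S(5) south by simp
    qed
  qed
  show "\<not> attaches strength 2 (line xs) (line xs)" "\<not> attaches strength 2 (line ys) (line ys)"
    "\<not> attaches strength 2 (line (xs @ ys)) (line (xs @ ys))"
    "\<not> attaches strength 2 (line xs) (line (xs @ ys))" "\<not> attaches strength 2 (line ys) (line (xs @ ys))"
    using south ends ne by (simp_all add: lines_not_attach)
qed auto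

text \<open>The weak north side is what fillers hold on to, and the null south side keeps lines from
  bonding vertically. The matching of consecutive glues is recorded for the full connectedness of
  the square.\<close>

definition row :: "glue \<Rightarrow> glue \<Rightarrow> tile list \<Rightarrow> bool" where
  "row a b ts \<longleftrightarrow> ts \<noteq> [] \<and> west (hd ts) = a \<and> east (last ts) = b \<and>
     successively (\<lambda>t u. east t = west u) ts \<and>
     (\<forall>t\<in>set ts. north t = 4 \<and> south t = 0 \<and> east t \<in> {1, 2, 3} \<and> west t \<in> {1, 2, 3})"

lemma row_append: "row a b xs \<Longrightarrow> row b c ys \<Longrightarrow> row a c (xs @ ys)"
  by (auto simp: row_def successively_append_iff)

lemma row_ends: "row a b ts \<Longrightarrow> a \<in> {1, 2, 3} \<and> b \<in> {1, 2, 3}"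
  unfolding row_def using hd_in_set last_in_set by metis

lemma terminal_row:
  assumes "S \<subseteq> orbit (line ts)" "S \<noteq> {}" "row a b ts" "a \<noteq> b"
  shows "terminal strength 2 S = orbit (line ts)"
  using assms by (intro strength.terminal_single lines_not_attach) (auto simp: row_def)

text \<open>\<open>a \<noteq> b\<close> and \<open>b \<noteq> c\<close> keep the parts from sticking
  to themselves; \<open>a \<noteq> c\<close> does so for the joined line and forbids joining the
  parts in the opposite order.\<close>

lemma terminal_rows:
  assumes "S \<subseteq> orbit (line xs) \<union> orbit (line ys)" "S \<inter> orbit (line xs) \<noteq> {}" "S \<inter> orbit (line ys) \<noteq> {}"
    and "row a b xs" "row b c ys" "a \<noteq> b" "b \<noteq> c" "a \<noteq> c"
  shows "terminal strength 2 S = orbit (line (xs @ ys))"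
  using assms row_ends[of a b xs] by (intro terminal_lines) (auto simp: row_def)

section \<open>The L-shaped frame\<close>

text \<open>Symmetric under \<open>flip_tile\<close>: row and column both start with glue 1. The
  null outer sides keep frames apart.\<close>

definition corner :: tile where "corner = (1, 1, 0, 0)"
definition filler :: tile where "filler = (4, 4, 4, 4)"

lemma corner_sides [simp]: "north corner = 1" "east corner = 1" "south corner = 0" "west corner = 0"
  by (simp_all add: corner_def north_def east_def south_def west_def)

lemma filler_sides [simp]: "north filler = 4" "east filler = 4" "south filler = 4" "west filler = 4"
  by (simp_all add: filler_def north_def east_def south_def west_def)

definition frame :: "tile list \<Rightarrow> supertile" where
  "frame ts = line (corner # ts) ++ translate (0, 1) (flip (line ts))"

definition filled :: "tile list \<Rightarrow> pos set \<Rightarrow> supertile" where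
  "filled ts D = (\<lambda>p. if p \<in> D then Some filler else frame ts p)"

abbreviation inner :: "tile list \<Rightarrow> pos set" where
  "inner ts \<equiv> {1..int (length ts)} \<times> {1..int (length ts)}"

text \<open>These are the order ideals of the inner grid, that is, Young diagrams anchored at (1,
  1): the patterns that arise when each filler needs support from the west and the south.\<close>

definition fillable :: "tile list \<Rightarrow> pos set \<Rightarrow> bool" where
  "fillable ts D \<longleftrightarrow> D \<subseteq> inner ts \<and>
     (\<forall>x y. (x, y) \<in> D \<longrightarrow> (x = 1 \<or> (x - 1, y) \<in> D) \<and> (y = 1 \<or> (x, y - 1) \<in> D))"

lemma filled_empty: "filled ts {} = frame ts"
  by (simp add: filled_def)

lemma fillable_empty: "fillable ts {}"
  by (simp add: fillable_def)

lemma frame_apply: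
  "frame ts (x, y) =
    (if x = 0 \<and> 1 \<le> y \<and> y \<le> int (length ts) then Some (flip_tile (ts ! nat (y - 1)))
     else if y = 0 \<and> 0 \<le> x \<and> x \<le> int (length ts) then Some ((corner # ts) ! nat x) else None)"
  by (auto simp: frame_def map_add_def translate_apply flip_apply line_apply)

lemma frame_Some:
  assumes "frame ts (x, y) = Some t"
  obtains (corner) "x = 0" "y = 0" "t = corner"
  | (row) "y = 0" "1 \<le> x" "x \<le> int (length ts)" "t = ts ! nat (x - 1)" "t \<in> set ts"
  | (column) "x = 0" "1 \<le> y" "y \<le> int (length ts)" "t = flip_tile (ts ! nat (y - 1))"
      "flip_tile t \<in> set ts"
proof (cases "x = 0")
  case True
  show thesis
    using assms True that by (cases "y = 0") (auto simp: frame_apply nat_less_iff split: if_splits)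
next
  case False
  then have "y = 0" "1 \<le> x" "x \<le> int (length ts)" "t = ts ! nat (x - 1)"
    using assms by (auto simp: frame_apply nth_Cons' nat_diff_distrib split: if_splits)
  then show thesis using that(2) by auto
qed

lemma finite_dom_frame [simp]: "finite (dom (frame ts))"
  by (simp add: frame_def)

lemma finite_dom_filled: "fillable ts D \<Longrightarrow> finite (dom (filled ts D))"
proof -
  assume "fillable ts D"
  then have "finite D" unfolding fillable_def using finite_subset by blast
  moreover have "dom (filled ts D) \<subseteq> D \<union> dom (frame ts)"
    by (auto simp: filled_def split: if_splits)
  ultimately show ?thesis by (meson finite_Un finite_dom_frame finite_subset)
qed

text \<open>Support covers the west and south face of every filler, so on those sides only null
  glues of the frame stay visible. To the north and east the weak glue shows, together with the end
  glue \<open>b\<close> at the tip of each arm.\<close>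

lemma exposed_filled:
  assumes row: "row 1 b ts" and D: "fillable ts D"
  shows "exposed_north (filled ts D) \<subseteq> {b, 4}" "exposed_east (filled ts D) \<subseteq> {b, 4}"
    "exposed_south (filled ts D) \<subseteq> {0}" "exposed_west (filled ts D) \<subseteq> {0}"
proof -
  let ?m = "int (length ts)"
  have m: "1 \<le> ?m" using row by (cases ts) (auto simp: row_def)
  have last: "t = last ts" if "t = ts ! nat (?m - 1)" for t
    using that m row by (simp add: row_def last_conv_nth nat_diff_distrib)
  have side: "north t = 4" "south t = 0" if "t \<in> set ts" for t
    using that row by (auto simp: row_def)
  have east_last: "east (last ts) = b" using row by (simp add: row_def)
  show "exposed_north (filled ts D) \<subseteq> {b, 4}"
  proof
    fix g assume "g \<in> exposed_north (filled ts D)"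
    then obtain t x y where t: "g = north t" "filled ts D (x, y) = Some t" "filled ts D (x, y + 1) = None"
      by (auto simp: exposed_north_def)
    show "g \<in> {b, 4}"
    proof (cases "(x, y) \<in> D")
      case True then show ?thesis using t by (simp add: filled_def)
    next
      case False
      then have "frame ts (x, y) = Some t" using t by (simp add: filled_def)
      then show ?thesis
      proof (cases rule: frame_Some)
        case corner then show ?thesis using t m by (simp add: filled_def frame_apply split: if_splits)
      next
        case row then show ?thesis using t side by simp
      next
        case column
        then have "y = ?m" using t by (auto simp: filled_def frame_apply split: if_splits)
        then show ?thesis using column last[of "flip_tile t"] east_last t by (metis flip_tile_flip_tile flip_tile_sides(1) insertI1)
      qed
    qed
  qed
  show "exposed_east (filled ts D) \<subseteq> {b, 4}"
  proof
    fix g assume "g \<in> exposed_east (filled ts D)"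
    then obtain t x y where t: "g = east t" "filled ts D (x, y) = Some t" "filled ts D (x + 1, y) = None"
      by (auto simp: exposed_east_def)
    show "g \<in> {b, 4}"
    proof (cases "(x, y) \<in> D")
      case True then show ?thesis using t by (simp add: filled_def)
    next
      case False
      then have "frame ts (x, y) = Some t" using t by (simp add: filled_def)
      then show ?thesis
      proof (cases rule: frame_Some)
        case corner then show ?thesis using t m by (simp add: filled_def frame_apply split: if_splits)
      next
        case row
        then have "x = ?m" using t by (auto simp: filled_def frame_apply split: if_splits)
        then show ?thesis using row last[of t] east_last t by auto
      next
        case column then show ?thesis using t side(1)[of "flip_tile t"] by simp
      qed
    qed
  qed
  show "exposed_south (filled ts D) \<subseteq> {0}"
  proof
    fix g assume "g \<in> exposed_south (filled ts D)"
    then obtain t x y where t: "g = south t" "filled ts D (x, y) = Some t" "filled ts D (x, y - 1) = None"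
      by (auto simp: exposed_south_def)
    have nD: "(x, y) \<notin> D"
    proof
      assume xy: "(x, y) \<in> D"
      then have "y = 1 \<or> (x, y - 1) \<in> D" "1 \<le> x" "x \<le> ?m" using D by (auto simp: fillable_def)
      then show False using t by (auto simp: filled_def frame_apply split: if_splits)
    qed
    then have "frame ts (x, y) = Some t" using t by (simp add: filled_def)
    then show "g \<in> {0}"
    proof (cases rule: frame_Some)
      case corner then show ?thesis using t by simp
    next
      case row then show ?thesis using t side by simp
    next
      case column
      then show ?thesis using t by (auto simp: filled_def frame_apply split: if_splits)
    qed
  qed
  show "exposed_west (filled ts D) \<subseteq> {0}"
  proof
    fix g assume "g \<in> exposed_west (filled ts D)"
    then obtain t x y where t: "g = west t" "filled ts D (x, y) = Some t" "filled ts D (x - 1, y) = None"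
      by (auto simp: exposed_west_def)
    have nD: "(x, y) \<notin> D"
    proof
      assume xy: "(x, y) \<in> D"
      then have "x = 1 \<or> (x - 1, y) \<in> D" "1 \<le> y" "y \<le> ?m" using D by (auto simp: fillable_def)
      then show False using t by (auto simp: filled_def frame_apply split: if_splits)
    qed
    then have "frame ts (x, y) = Some t" using t by (simp add: filled_def)
    then show "g \<in> {0}"
    proof (cases rule: frame_Some)
      case corner then show ?thesis using t by simp
    next
      case row then show ?thesis using t by (auto simp: filled_def frame_apply split: if_splits)
    next
      case column
      then show ?thesis using t side(2)[of "flip_tile t"] by simp
    qed
  qed
qed

lemma terminal_corner_row:
  assumes S: "S \<subseteq> orbit (line [corner]) \<union> orbit (line ts)" "S \<inter> orbit (line [corner]) \<noteq> {}"
      "S \<inter> orbit (line ts) \<noteq> {}"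
    and "row 1 b ts" "b \<noteq> 1"
  shows "terminal strength 2 S = orbit (line (corner # ts))"
  using terminal_lines[OF S] assms(4,5) row_ends[of 1 b ts] by (auto simp: row_def)

text \<open>Glue 1 is exposed to the north only at the corner and to the south only at the foot of
  the column, so there is a single way to join the two parts.\<close>

lemma terminal_frame:
  assumes S: "S \<subseteq> orbit (line (corner # ts)) \<union> orbit (flip (line ts))"
      "S \<inter> orbit (line (corner # ts)) \<noteq> {}" "S \<inter> orbit (flip (line ts)) \<noteq> {}"
    and row: "row 1 b ts" "b \<noteq> 1"
  shows "terminal strength 2 S = orbit (frame ts)"
proof (rule strength.terminal_pair[OF S])
  let ?A = "line (corner # ts)" and ?B = "flip (line ts)"
  have ne: "ts \<noteq> []" and hd: "west (hd ts) = 1" and last: "east (last ts) = b"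
    using row by (auto simp: row_def)
  have side: "north t = 4" "south t = 0" "east t \<in> {1, 2, 3}" "west t \<in> {1, 2, 3}" if "t \<in> set ts" for t
    using that row by (auto simp: row_def)
  have b: "b \<in> {2, 3}" using row row_ends[of 1 b ts] by auto
  have colS: "north u = 4" "south u = 0" if "flip (line ts) (x, y) = Some (flip_tile u)" for x y u
  proof -
    from that obtain t where t: "line ts (y, x) = Some t" "flip_tile t = flip_tile u" by (auto simp: flip_apply)
    then have "t = u" by (metis flip_tile_flip_tile)
    then show "north u = 4" "south u = 0" using t line_tile side by blast+
  qed
  have col: "east u = 4" "west u = 0" if "flip (line ts) (x, y) = Some u" for x y u
    using colS[of x y "flip_tile u"] that by simp_all
  have A_cases: "t = corner \<and> x = 0 \<or> t \<in> set ts \<and> x \<noteq> 0" if "?A (x, y) = Some t" for x y t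
    using that by (cases "nat x") (auto simp: line_Some)
  have rowside: "south t = 0" "west t \<noteq> 4" "north t \<in> {1, 4}" "north t = 1 \<longleftrightarrow> x = 0"
    if "?A (x, y) = Some t" for x y t
    using A_cases[OF that] side[of t] by auto
  have exA: "exposed_north ?A \<subseteq> {1, 4}" "exposed_south ?A \<subseteq> {0}"
    by (rule exposed_subsetI, metis rowside(3)) (rule exposed_subsetI, metis rowside(1) singletonI)
  have exA': "exposed_west ?A \<subseteq> {0}" "exposed_east ?A \<subseteq> {b}"
    using exposed_line[of "corner # ts"] last ne by simp_all
  note exA = exA exA'
  have firstB: "x = 0 \<and> y = 0 \<and> u = flip_tile (hd ts)" if "?B (x, y) = Some u" "?B (x, y - 1) = None" for x y u
    using that line_first[of ts y x "flip_tile u"] by (auto simp: flip_apply)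
  have lastB: "u = flip_tile (last ts)" if "?B (x, y) = Some u" "?B (x, y + 1) = None" for x y u
    using that line_last[of ts y x "flip_tile u"] by (auto simp: flip_apply)
  have exB: "exposed_west ?B \<subseteq> {0}" "exposed_east ?B \<subseteq> {4}"
    by (rule exposed_subsetI, metis col(2) singletonI) (rule exposed_subsetI, metis col(1) singletonI)
  have exB': "exposed_north ?B \<subseteq> {b}" "exposed_south ?B \<subseteq> {1}"
    by (rule exposed_subsetI, metis lastB last flip_tile_sides(1) singletonI)
      (rule exposed_subsetI, metis firstB hd flip_tile_sides(3) singletonI)
  note exB = exB exB'
  have exC: "exposed_north (frame ts) \<subseteq> {b, 4}" "exposed_east (frame ts) \<subseteq> {b, 4}"
    "exposed_south (frame ts) \<subseteq> {0}" "exposed_west (frame ts) \<subseteq> {0}"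
    using exposed_filled[OF row(1) fillable_empty] by (simp_all add: filled_empty)
  have na: "\<not> attaches strength 2 P Q"
    if "exposed_north P \<inter> exposed_south Q \<subseteq> {0}" "exposed_east P \<inter> exposed_west Q \<subseteq> {0}"
      "exposed_south P \<inter> exposed_north Q \<subseteq> {0}" "exposed_west P \<inter> exposed_east Q \<subseteq> {0}" for P Q
    using that by (intro not_attaches) (simp_all add: strength_disjoint)
  show "\<not> attaches strength 2 ?A ?A" by (rule na) (use exA b in auto)
  show "\<not> attaches strength 2 ?B ?B" by (rule na) (use exB b in auto)
  show "\<not> attaches strength 2 (frame ts) (frame ts)" by (rule na) (use exC b in auto)
  show "\<not> attaches strength 2 ?A (frame ts)" by (rule na) (use exA exC b in auto)
  \<comment> \<open>This pair depends on \<open>b \<noteq> 1\<close>: otherwise a further column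
    could stand on the tip of the frame's column.\<close>
  show "\<not> attaches strength 2 ?B (frame ts)" by (rule na) (use exB exC b in auto)
  show "frame ts = ?A ++ translate (0, 1) ?B" by (simp add: frame_def)
  show "dom ?A \<inter> dom (translate (0, 1) ?B) = {}"
    by (auto simp: line_Some translate_apply flip_apply)
  have c: "?A (0, 0) = Some corner" by (simp add: line_Some)
  have "translate (0, 1) ?B (0, 1) = Some (flip_tile (hd ts))"
    using ne by (simp add: translate_apply flip_apply line_apply hd_conv_nth)
  then have "2 \<le> contrib strength ?A (translate (0, 1) ?B) (0, 0)"
    using c hd by (simp add: contrib_def strength_def)
  then show "2 \<le> bond strength ?A (translate (0, 1) ?B)"
    using contrib_le_bond[OF finite_dom_line, of "(0, 0)" "corner # ts"] c order_trans by blast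
  show "w = (0, 1)" if w: "dom ?A \<inter> dom (translate w ?B) = {}" "2 \<le> bond strength ?A (translate w ?B)" for w
  proof -
    have "0 < bond strength ?A (translate w ?B)" using w by simp
    from w(1) this show ?thesis
    proof (cases rule: bond_pos_cases)
      case (E x y t u)
      then show ?thesis using col by (auto simp: translate_apply)
    next
      case (W x y t u)
      then have "east u = 4" "west t \<noteq> 4" using col rowside by (auto simp: translate_apply)
      then show ?thesis using W(5) by (simp add: strength_neq)
    next
      case (N x y t u)
      have "?B (x - fst w, y + 1 - snd w) = Some u" "?B (x - fst w, y + 1 - snd w - 1) = None"
        using N by (simp_all add: translate_apply algebra_simps)
      from firstB[OF this] have *: "x = fst w" "y + 1 = snd w" "u = flip_tile (hd ts)" by simp_all
      then have "north t = 1" using N(5) hd by (auto simp: strength_def split: if_splits)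
      then have "x = 0" "y = 0" using rowside(4)[OF N(1)] N(1) by (auto simp: line_Some)
      then show ?thesis using * by (simp add: prod_eq_iff)
    next
      case (S x y t u)
      then show ?thesis using rowside by auto
    qed
  qed
qed auto

section \<open>Filling the frame\<close>

lemma translate_single: "translate v (single t) = [v \<mapsto> t]"
  by (auto simp: translate_def single_def fun_eq_iff prod_eq_iff)

lemma bond_translate_single:
  "bond G (translate (x, y) (single t)) B =
      (case B (x + 1, y) of None \<Rightarrow> 0 | Some u \<Rightarrow> G (east t) (west u))
    + (case B (x - 1, y) of None \<Rightarrow> 0 | Some u \<Rightarrow> G (west t) (east u))
    + (case B (x, y + 1) of None \<Rightarrow> 0 | Some u \<Rightarrow> G (north t) (south u))
    + (case B (x, y - 1) of None \<Rightarrow> 0 | Some u \<Rightarrow> G (south t) (north u))"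
  by (simp add: bond_def translate_single contrib_def)

text \<open>Two cells share at most one edge, and one weak edge contributes only 1.\<close>

lemma filler_inert: "\<not> attaches strength 2 (single filler) (single filler)"
proof -
  have "bond strength (translate (0, 0) (single filler)) (translate v (single filler)) < 2" for v
    unfolding bond_translate_single by (cases v) (auto simp: translate_single strength_def)
  then show ?thesis by (auto simp: attaches_def not_le)
qed

lemma filled_insert: "filled ts D ++ translate v (single filler) = filled ts (insert v D)"
  by (auto simp: filled_def translate_single fun_eq_iff map_add_def)

lemma filled_None_iff: "(x, y) \<in> inner ts \<Longrightarrow> filled ts D (x, y) = None \<longleftrightarrow> (x, y) \<notin> D"
  by (auto simp: filled_def frame_apply)

lemma bond_filled_filler:
  assumes "fillable ts D"
  shows "bond strength (filled ts D) (translate v (single filler)) =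
    bond strength (translate v (single filler)) (filled ts D)"
  using assms by (intro bond_commute strength.commute) (simp_all add: finite_dom_filled single_def)

lemma strength_filler: "strength 4 g = (if g = 4 then 1 else 0)"
  by (simp add: strength_def)

text \<open>By \<open>exposed_filled\<close> nothing holds a filler from the east or north, while
  the west and south neighbours contribute at most 1 each. Temperature 2 therefore demands both,
  which is the growth rule of \<open>fillable\<close>.\<close>

lemma filler_attaches_iff:
  assumes row: "row 1 b ts" "b \<noteq> 1" and D: "fillable ts D"
  shows "dom (filled ts D) \<inter> dom (translate v (single filler)) = {} \<and>
      2 \<le> bond strength (filled ts D) (translate v (single filler)) \<longleftrightarrow>
    v \<notin> D \<and> fillable ts (insert v D)" (is "?L \<longleftrightarrow> ?R")
proof -
  obtain x y where v: "v = (x, y)" by (cases v)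
  let ?m = "int (length ts)" and ?F = "filled ts D"
  have side: "north t = 4" "east t \<noteq> 4" if "t \<in> set ts" for t
    using that row by (auto simp: row_def)
  show ?thesis
  proof
    assume ?L
    then have free: "?F (x, y) = None" and
      bond: "2 \<le> bond strength (translate (x, y) (single filler)) ?F"
      using bond_filled_filler[OF D] by (auto simp: v translate_single)
    \<comment> \<open>A tile to the east would show its west face at the free cell, and such faces
      carry only null; the same holds to the north.\<close>
    have "(case ?F (x + 1, y) of None \<Rightarrow> 0 | Some u \<Rightarrow> strength 4 (west u)) = 0"
      using exposedI(4)[of ?F "x + 1" y] exposed_filled(4)[OF row(1) D] free
      by (fastforce split: option.split)
    moreover have "(case ?F (x, y + 1) of None \<Rightarrow> 0 | Some u \<Rightarrow> strength 4 (south u)) = 0"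
      using exposedI(3)[of ?F x "y + 1"] exposed_filled(3)[OF row(1) D] free
      by (fastforce split: option.split)
    ultimately have two: "2 \<le> (case ?F (x - 1, y) of None \<Rightarrow> 0 | Some u \<Rightarrow> strength 4 (east u))
        + (case ?F (x, y - 1) of None \<Rightarrow> 0 | Some u \<Rightarrow> strength 4 (north u))"
      using bond unfolding bond_translate_single filler_sides by linarith
    have west_le: "(case ?F (x - 1, y) of None \<Rightarrow> 0 | Some u \<Rightarrow> strength 4 (east u)) \<le> 1"
      and south_le: "(case ?F (x, y - 1) of None \<Rightarrow> 0 | Some u \<Rightarrow> strength 4 (north u)) \<le> 1"
      by (simp_all add: strength_filler split: option.split)
    have "0 < (case ?F (x - 1, y) of None \<Rightarrow> 0 | Some u \<Rightarrow> strength 4 (east u))"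
      using two south_le by linarith
    then obtain t where t: "?F (x - 1, y) = Some t" "east t = 4"
      by (cases "?F (x - 1, y)") (simp_all add: strength_filler split: if_splits)
    have "0 < (case ?F (x, y - 1) of None \<Rightarrow> 0 | Some u \<Rightarrow> strength 4 (north u))"
      using two west_le by linarith
    then obtain u where u: "?F (x, y - 1) = Some u" "north u = 4"
      by (cases "?F (x, y - 1)") (simp_all add: strength_filler split: if_splits)
    have nD: "(x, y) \<notin> D" using free by (auto simp: filled_def)
    \<comment> \<open>Row tiles and the corner have strong east glues, so a west neighbour with east
      glue 4 is a filler or a column tile; the latter forces \<open>x = 1\<close>.\<close>
    have west: "x = 1 \<and> 1 \<le> y \<and> y \<le> ?m \<or> (x - 1, y) \<in> D"
    proof (rule disjCI)
      assume "(x - 1, y) \<notin> D"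
      then have "frame ts (x - 1, y) = Some t" using t by (simp add: filled_def)
      then show "x = 1 \<and> 1 \<le> y \<and> y \<le> ?m"
        using t(2) side by (cases rule: frame_Some) auto
    qed
    have south: "y = 1 \<and> 1 \<le> x \<and> x \<le> ?m \<or> (x, y - 1) \<in> D"
    proof (rule disjCI)
      assume "(x, y - 1) \<notin> D"
      then have "frame ts (x, y - 1) = Some u" using u by (simp add: filled_def)
      then show "y = 1 \<and> 1 \<le> x \<and> x \<le> ?m"
        using u(2) side(2)[of "flip_tile u"] by (cases rule: frame_Some) auto
    qed
    have "(x, y) \<in> inner ts"
      using west south D by (auto simp: fillable_def)
    then show ?R
      using west south D nD by (auto simp: fillable_def v)
  next
    assume R: ?R
    then have xy: "(x, y) \<in> inner ts" "x = 1 \<or> (x - 1, y) \<in> D" "y = 1 \<or> (x, y - 1) \<in> D"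
      by (auto simp: fillable_def v)
    then have free: "?F (x, y) = None" using R by (simp add: filled_None_iff v)
    have "\<exists>t. ?F (x - 1, y) = Some t \<and> east t = 4"
    proof (cases "(x - 1, y) \<in> D")
      case True then show ?thesis by (simp add: filled_def)
    next
      case False
      then have "?F (x - 1, y) = Some (flip_tile (ts ! nat (y - 1)))"
        using xy by (auto simp: filled_def frame_apply)
      moreover have "ts ! nat (y - 1) \<in> set ts" using xy by (auto simp: nat_less_iff)
      ultimately show ?thesis using side by simp
    qed
    moreover have "\<exists>t. ?F (x, y - 1) = Some t \<and> north t = 4"
    proof (cases "(x, y - 1) \<in> D")
      case True then show ?thesis by (simp add: filled_def)
    next
      case False
      then have "?F (x, y - 1) = Some (ts ! nat (x - 1))"
        using xy by (auto simp: filled_def frame_apply nth_Cons' nat_diff_distrib)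
      moreover have "ts ! nat (x - 1) \<in> set ts" using xy by (auto simp: nat_less_iff)
      ultimately show ?thesis using side by simp
    qed
    ultimately have "2 \<le> bond strength (translate (x, y) (single filler)) ?F"
      unfolding bond_translate_single by (auto simp: strength_filler)
    then show ?L using free bond_filled_filler[OF D] by (auto simp: v translate_single)
  qed
qed

text \<open>A missing inner cell with least coordinate sum has its west and south neighbours in
  \<open>D\<close> or on the frame, so it can be added.\<close>

lemma fillable_extend:
  assumes "fillable ts D" "D \<noteq> inner ts"
  obtains v where "v \<notin> D" "fillable ts (insert v D)"
proof -
  let ?P = "\<lambda>p. p \<in> inner ts - D"
  obtain p where "?P p" using assms unfolding fillable_def by blast
  from ex_has_least_nat[of ?P, OF this, of "\<lambda>q. nat (fst q + snd q)"]
  obtain p where p: "?P p" "\<And>q. ?P q \<Longrightarrow> nat (fst p + snd p) \<le> nat (fst q + snd q)"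
    by blast
  obtain x y where xy: "p = (x, y)" by fastforce
  note min = p[unfolded xy fst_conv snd_conv]
  have "x = 1 \<or> (x - 1, y) \<in> D"
  proof (rule ccontr)
    assume "\<not> ?thesis"
    then have "?P (x - 1, y)" using min(1) by auto
    from min(2)[OF this] min(1) show False by (simp; arith)
  qed
  moreover have "y = 1 \<or> (x, y - 1) \<in> D"
  proof (rule ccontr)
    assume "\<not> ?thesis"
    then have "?P (x, y - 1)" using min(1) by auto
    from min(2)[OF this] min(1) show False by (simp; arith)
  qed
  ultimately have "fillable ts (insert (x, y) D)"
    using assms(1) min(1) by (auto simp: fillable_def)
  then show thesis using that min(1) by auto
qed

lemma filled_inert:
  assumes row: "row 1 b ts" "b \<noteq> 1" and D: "fillable ts D" "fillable ts E"
  shows "\<not> attaches strength 2 (filled ts D) (filled ts E)"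
proof -
  have "b \<in> {2, 3}" using row row_ends[of 1 b ts] by auto
  then show ?thesis
    using exposed_filled[OF row(1) D(1)] exposed_filled[OF row(1) D(2)]
    by (intro not_attaches strength_disjoint) auto
qed

text \<open>Invariant: every produced supertile is a lone filler or a frame with a fillable pattern,
  and each combination adds one cell. Proper patterns can be extended and are not terminal; the full
  one leaves no cell for a filler.\<close>

lemma terminal_filled:
  assumes S: "S \<subseteq> orbit (frame ts) \<union> orbit (single filler)" "S \<inter> orbit (frame ts) \<noteq> {}"
      "S \<inter> orbit (single filler) \<noteq> {}"
    and row: "row 1 b ts" "b \<noteq> 1"
  shows "terminal strength 2 S = orbit (filled ts (inner ts))"
proof -
  let ?P = "produced strength 2 S" and ?f = "single filler"
  have step: "X ++ Y \<in> orbit (filled ts (insert v D)) \<and> fillable ts (insert v D) \<and> v \<notin> D"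
    if "fillable ts D" "X = translate u (filled ts D)" "Y = translate u (translate v ?f)"
      "dom (filled ts D) \<inter> dom (translate v ?f) = {}" "2 \<le> bond strength (filled ts D) (translate v ?f)"
    for X Y u v D
  proof -
    have "v \<notin> D \<and> fillable ts (insert v D)" using filler_attaches_iff[OF row that(1)] that(4,5) by blast
    moreover have "X ++ Y = translate u (filled ts (insert v D))"
      using that(2,3) by (simp only: translate_map_add[symmetric] filled_insert)
    ultimately show ?thesis by simp
  qed
  have attach: "\<exists>v. X ++ Y \<in> orbit (filled ts (insert v D)) \<and> fillable ts (insert v D) \<and> v \<notin> D"
    if D: "fillable ts D" and XY: "X \<in> orbit (filled ts D)" "Y \<in> orbit ?f" "dom X \<inter> dom Y = {}" "2 \<le> bond strength X Y"
    for X Y D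
    using XY by (rule attachesI) (use step[OF D] in blast)
  have fin: "finite (dom X)" if "fillable ts D" "X \<in> orbit (filled ts D) \<union> orbit ?f" for X D
    using that finite_dom_filled by (auto simp: orbit_def single_def)
  have attach': "\<exists>v. Y ++ X \<in> orbit (filled ts (insert v D)) \<and> fillable ts (insert v D) \<and> v \<notin> D"
    if D: "fillable ts D" and XY: "X \<in> orbit (filled ts D)" "Y \<in> orbit ?f" "dom Y \<inter> dom X = {}" "2 \<le> bond strength Y X"
    for X Y D
  proof -
    have "bond strength X Y = bond strength Y X"
      using fin[OF D] XY by (intro bond_commute strength.commute) auto
    moreover have "Y ++ X = X ++ Y" by (rule map_add_comm) (use XY in auto)
    ultimately show ?thesis using attach[OF D XY(1,2)] XY(3,4) by (metis Int_commute)
  qed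
  define K where "K = orbit ?f \<union> (\<Union>D\<in>{D. fillable ts D}. orbit (filled ts D))"
  have K: "X \<in> K" if "X \<in> ?P" for X
    using that
  proof induction
    case (init X)
    then show ?case using S(1) fillable_empty filled_empty[of ts] by (fastforce simp: K_def)
  next
    case (transl X v)
    then show ?case unfolding K_def using orbit_translate[of X _ v] by blast
  next
    case (comb X Y)
    then consider "X \<in> orbit ?f" "Y \<in> orbit ?f"
      | D where "X \<in> orbit ?f" "fillable ts D" "Y \<in> orbit (filled ts D)"
      | D where "Y \<in> orbit ?f" "fillable ts D" "X \<in> orbit (filled ts D)"
      | D E where "fillable ts D" "X \<in> orbit (filled ts D)" "fillable ts E" "Y \<in> orbit (filled ts E)"
      by (auto simp: K_def)
    then show ?case
    proof cases
      case 1 then show ?thesis using attaches_if_orbit filler_inert comb by blast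
    next
      case 2 then show ?thesis using attach'[OF 2(2,3,1)] comb by (auto simp: K_def)
    next
      case 3 then show ?thesis using attach[OF 3(2,3,1)] comb by (auto simp: K_def)
    next
      case 4 then show ?thesis using attaches_if_orbit filled_inert[OF row 4(1,3)] comb by blast
    qed
  qed
  have filler: "orbit ?f \<subseteq> ?P" and frame: "orbit (frame ts) \<subseteq> ?P"
    using S produced_meets_orbit by blast+
  have extend: "dom X \<inter> dom Y = {}" "2 \<le> bond strength X Y" "Y \<in> ?P"
    if "X = translate u (filled ts D)" "Y = translate u (translate v ?f)"
      "fillable ts D" "v \<notin> D" "fillable ts (insert v D)" for X Y u v D
  proof -
    have "dom (filled ts D) \<inter> dom (translate v ?f) = {} \<and> 2 \<le> bond strength (filled ts D) (translate v ?f)"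
      using that filler_attaches_iff[OF row that(3)] by blast
    then show "dom X \<inter> dom Y = {}" "2 \<le> bond strength X Y"
      unfolding that(1,2) dom_translate_disjoint bond_translate by auto
    show "Y \<in> ?P" using filler that(2) by (auto simp: orbit_def)
  qed
  have not_terminal: "X \<notin> terminal strength 2 S"
    if X: "X \<in> orbit (filled ts D)" and D: "fillable ts D" "D \<noteq> inner ts" for X D
  proof -
    obtain u where u: "X = translate u (filled ts D)" using X by (auto simp: orbit_def)
    obtain v where "v \<notin> D" "fillable ts (insert v D)" using fillable_extend D by blast
    from extend[OF u refl D(1) this] show ?thesis by (auto simp: terminal_def not_less)
  qed
  have filler_not_terminal: "X \<notin> terminal strength 2 S" if X: "X \<in> orbit ?f" for X
  proof -
    \<comment> \<open>A lone filler is not terminal because it fits into the empty frame; a nonempty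
      \<open>ts\<close> supplies an inner cell.\<close>
    have "ts \<noteq> []" using row by (simp add: row_def)
    then have "(1, 1) \<in> inner ts" by (cases ts) auto
    then have "{} \<noteq> inner ts" by blast
    then obtain v where v: "fillable ts (insert v {})"
      using fillable_extend[OF fillable_empty] by metis
    obtain u where u: "X = translate u (translate v ?f)"
      using X orbit_related[of "translate v ?f" ?f X] by auto
    let ?F = "translate u (filled ts {})"
    have "dom ?F \<inter> dom X = {}" "2 \<le> bond strength ?F X"
      using extend[OF refl u fillable_empty _ v] by auto
    moreover have "bond strength ?F X = bond strength X ?F"
      using X fin[OF fillable_empty] by (intro bond_commute strength.commute) auto
    moreover have "?F \<in> ?P" using frame by (auto simp: orbit_def filled_empty)
    ultimately show ?thesis by (fastforce simp: terminal_def not_less)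
  qed
  have sub: "terminal strength 2 S \<subseteq> orbit (filled ts (inner ts))"
  proof
    fix X assume X: "X \<in> terminal strength 2 S"
    then have "X \<in> K" using K by (simp add: terminal_def)
    then show "X \<in> orbit (filled ts (inner ts))"
      using X not_terminal filler_not_terminal by (auto simp: K_def)
  qed
  \<comment> \<open>Among the finitely many produced patterns, one with the most cells cannot be
    extended, so it is the whole inner square.\<close>
  let ?Q = "\<lambda>D. fillable ts D \<and> filled ts D \<in> ?P"
  have fins: "finite {D. ?Q D}"
    by (rule finite_subset[of _ "Pow (inner ts)"]) (auto simp: fillable_def)
  have "?Q {}" using fillable_empty frame by (auto simp: filled_empty)
  then obtain D where D: "?Q D" "\<And>E. ?Q E \<Longrightarrow> card E \<le> card D"
    using Max_in[of "card ` {D. ?Q D}"] Max_ge[of "card ` {D. ?Q D}"] fins by fastforce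
  have "D = inner ts"
  proof (rule ccontr)
    assume "D \<noteq> inner ts"
    then obtain v where v: "v \<notin> D" "fillable ts (insert v D)" using fillable_extend D by blast
    from extend[of _ "(0, 0)", OF _ _ _ this]
    have "filled ts D ++ translate v ?f \<in> ?P"
      using D(1) by (intro produced.comb) auto
    then have "card (insert v D) \<le> card D" using D(2) v by (simp add: filled_insert)
    moreover have "finite D" using D(1) finite_subset by (auto simp: fillable_def)
    ultimately show False using v by simp
  qed
  with D(1) have full: "fillable ts (inner ts)" "filled ts (inner ts) \<in> ?P" by auto
  have "X \<in> terminal strength 2 S" if X: "X \<in> orbit (filled ts (inner ts))" for X
  proof -
    have "bond strength X Y < 2" if Y: "Y \<in> ?P" "dom X \<inter> dom Y = {}" for Y
    proof (rule ccontr)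
      assume "\<not> bond strength X Y < 2"
      then have b: "2 \<le> bond strength X Y" by simp
      from K[OF Y(1)] consider "Y \<in> orbit ?f" | E where "fillable ts E" "Y \<in> orbit (filled ts E)"
        by (auto simp: K_def)
      then show False
      proof cases
        case 1
        \<comment> \<open>The new cell would lie outside the inner square, contrary to
          \<open>fillable\<close>.\<close>
        from attach[OF full(1) X 1 Y(2) b] show False by (auto simp: fillable_def)
      next
        case 2 then show False using attaches_if_orbit[OF X _ Y(2) b] filled_inert[OF row full(1)] by blast
      qed
    qed
    moreover have "X \<in> ?P" using X full(2) by (auto simp: orbit_def intro: produced.transl)
    ultimately show ?thesis by (simp add: terminal_def)
  qed
  with sub show ?thesis by blast
qed

section \<open>Shape and connectedness of the completed square\<close>

lemma dom_filled: "dom (filled ts (inner ts)) = square (length ts + 1)"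
proof -
  have "filled ts (inner ts) p = None \<longleftrightarrow> p \<notin> square (length ts + 1)" for p
    by (cases p) (auto simp: filled_def frame_apply square_def)
  then show ?thesis by (simp add: set_eq_iff domIff)
qed

lemma fully_connected_translate: "fully_connected G A \<Longrightarrow> fully_connected G (translate v A)"
proof -
  have shift: "a + 1 - b = a - b + 1" for a b :: int by simp
  show "fully_connected G A \<Longrightarrow> fully_connected G (translate v A)"
    unfolding fully_connected_def translate_apply shift by blast
qed

text \<open>Along the bottom and left edges consecutive glues match by \<open>row\<close>. Every
  other adjacent pair has a filler as its east or north member, and two weak glues meet
  there.\<close>

lemma fully_connected_filled:
  assumes row: "row 1 b ts"
  shows "fully_connected strength (filled ts (inner ts))"
proof -
  let ?m = "int (length ts)" and ?F = "filled ts (inner ts)"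
  have ne: "ts \<noteq> []" using row by (simp add: row_def)
  have side: "north t = 4" "south t = 0" "east t \<in> {1, 2, 3}" if "t \<in> set ts" for t
    using that row by (auto simp: row_def)
  have pos: "strength g g > 0" if "g \<in> {1, 2, 3, 4}" for g
    using that by (auto simp: strength_def)
  have link: "east ((corner # ts) ! k) = west ((corner # ts) ! Suc k)" "east ((corner # ts) ! k) \<in> {1, 2, 3}"
    if "k < length ts" for k
  proof -
    have "successively (\<lambda>t u. east t = west u) (corner # ts)"
      using row by (cases ts) (auto simp: row_def)
    then show "east ((corner # ts) ! k) = west ((corner # ts) ! Suc k)"
      using that by (simp add: successively_conv_nth)
    show "east ((corner # ts) ! k) \<in> {1, 2, 3}"
      using that side(3) by (cases k) auto
  qed
  have bottom: "?F (x, 0) = (if 0 \<le> x \<and> x \<le> ?m then Some ((corner # ts) ! nat x) else None)" for x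
    by (simp add: filled_def frame_apply)
  \<comment> \<open>At the origin \<open>flip_tile corner\<close> is just \<open>corner\<close>;
    written this way, the left edge is the reflection of the same list
    \<open>corner # ts\<close>.\<close>
  have left: "?F (0, y) = (if 1 \<le> y \<and> y \<le> ?m then Some (flip_tile ((corner # ts) ! nat y))
      else if y = 0 then Some (flip_tile corner) else None)" for y
    by (simp add: filled_def frame_apply nth_Cons' nat_diff_distrib flip_tile_def corner_def north_def east_def
        south_def west_def)
  show ?thesis
    unfolding fully_connected_def
  proof (intro conjI allI impI; elim conjE)
    fix x y t u assume t: "?F (x, y) = Some t" and u: "?F (x + 1, y) = Some u"
    show "0 < strength (east t) (west u)"
    proof (cases "y = 0")
      case True
      then have x: "0 \<le> x" "x + 1 \<le> ?m" "t = (corner # ts) ! nat x" "u = (corner # ts) ! nat (x + 1)"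
        using t u by (auto simp: bottom split: if_splits)
      then have "nat x < length ts" by linarith
      from link[OF this] x show ?thesis
        using pos[of "west (ts ! nat x)"] by (auto simp: nat_add_distrib)
    next
      case False
      then have "u = filler" using u t by (auto simp: filled_def frame_apply split: if_splits)
      moreover have "east t = 4"
      proof (cases "(x, y) \<in> inner ts")
        case True then show ?thesis using t by (simp add: filled_def)
      next
        case F: False
        then have "frame ts (x, y) = Some t" using t by (auto simp: filled_def split: if_splits)
        then show ?thesis using False side(1) by (cases rule: frame_Some) auto
      qed
      ultimately show ?thesis using pos by simp
    qed
  next
    fix x y t u assume t: "?F (x, y) = Some t" and u: "?F (x, y + 1) = Some u"
    show "0 < strength (north t) (south u)"
    proof (cases "x = 0")
      case True
      then have y: "0 \<le> y" "y + 1 \<le> ?m" "t = flip_tile ((corner # ts) ! nat y)"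
          "u = flip_tile ((corner # ts) ! nat (y + 1))"
        using t u by (auto simp: left split: if_splits)
      then have "nat y < length ts" by linarith
      from link[OF this] y show ?thesis
        using pos[of "west (ts ! nat y)"] by (auto simp: nat_add_distrib)
    next
      case False
      then have "u = filler" using u t by (auto simp: filled_def frame_apply split: if_splits)
      moreover have "north t = 4"
      proof (cases "(x, y) \<in> inner ts")
        case True then show ?thesis using t by (simp add: filled_def)
      next
        case F: False
        then have "frame ts (x, y) = Some t" using t by (auto simp: filled_def split: if_splits)
        then show ?thesis using False side(1) by (cases rule: frame_Some) auto
      qed
      ultimately show ?thesis using pos by simp
    qed
  qed
qed

section \<open>The staged system\<close>

text \<open>\<open>op s\<close> says whether the step from stage \<open>s\<close> to stage \<open>s + 1\<close> doubles the lines or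
  lengthens them by one tile.\<close>

fun line_length :: "(nat \<Rightarrow> bool) \<Rightarrow> nat \<Rightarrow> nat" where
  "line_length op 0 = 1"
| "line_length op (Suc s) = (if op s then 2 * line_length op s else Suc (line_length op s))"

lemma line_length_cong: "(\<And>i. i < s \<Longrightarrow> op i = op' i) \<Longrightarrow> line_length op s = line_length op' s"
  by (induction s) auto

text \<open>Halving \<open>m\<close> lowers the logarithm by at least 1 and costs at most two steps:
  a doubling and, for odd \<open>m\<close>, one appended tile.\<close>

lemma line_length_surj:
  assumes "m \<ge> 1"
  shows "\<exists>op s. line_length op s = m \<and> real s \<le> 2 * log 2 (real m)"
  using assms
proof (induction m rule: less_induct)
  case (less m)
  show ?case
  proof (cases "m = 1")
    case True
    then show ?thesis by (intro exI[of _ undefined] exI[of _ 0]) simp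
  next
    case False
    define k where "k = m div 2"
    have k: "1 \<le> k" "k < m" "2 * k \<le> m" using False less.prems by (auto simp: k_def)
    with less.IH obtain op s where s: "line_length op s = k" "real s \<le> 2 * log 2 (real k)" by blast
    have "1 + log 2 (real k) = log 2 (2 * real k)" using k by (subst log_mult) auto
    also have "\<dots> \<le> log 2 (real m)" using k by (subst log_le_cancel_iff) auto
    finally have bound: "real (s + 2) \<le> 2 * log 2 (real m)" using s(2) by simp
    \<comment> \<open>The length at \<open>s\<close> depends only on earlier choices and is
      unaffected. For even \<open>m\<close> the result is read off right after the doubling.\<close>
    let ?op = "op(s := True, Suc s := False)"
    have "line_length ?op s = k" using s(1) line_length_cong[of s ?op op] by simp
    then have "line_length ?op (Suc s) = 2 * k" "line_length ?op (Suc (Suc s)) = 2 * k + 1" by simp_all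
    moreover have "m = 2 * k \<or> m = 2 * k + 1" by (auto simp: k_def)
    ultimately have "line_length ?op (Suc s) = m \<or> line_length ?op (Suc (Suc s)) = m" by metis
    moreover have "real (Suc s) \<le> 2 * log 2 (real m)" "real (Suc (Suc s)) \<le> 2 * log 2 (real m)"
      using bound by simp_all
    ultimately show ?thesis by blast
  qed
qed

text \<open>In stage \<open>s\<close>, bin \<open>i\<close> holds a line that starts with glue \<open>Suc i\<close> and ends with glue
  \<open>Suc (succ s i)\<close>. The orientation of the cyclic order alternates, because joining the lines
  from \<open>i\<close> to \<open>j\<close> and from \<open>j\<close> to \<open>k\<close> yields one from \<open>i\<close> to \<open>k\<close>.\<close>

definition succ :: "nat \<Rightarrow> nat \<Rightarrow> nat" where
  "succ s i = (if even s then i + 1 else i + 2) mod 3"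

lemma succ_less [simp]: "succ s i < 3"
  by (simp add: succ_def)

lemma less_3_cases: "i < (3::nat) \<Longrightarrow> i = 0 \<or> i = 1 \<or> i = 2"
  by auto

lemma succ_neq: "i < 3 \<Longrightarrow> succ s i \<noteq> i"
  by (auto simp: succ_def dest!: less_3_cases)

text \<open>Modulo 3, two steps in one direction are one step in the other; hence the alternating
  orientation.\<close>

lemma succ_succ: "i < 3 \<Longrightarrow> succ s (succ s i) = succ (Suc s) i"
  by (auto simp: succ_def dest!: less_3_cases)

text \<open>\<open>Suc\<close> shifts the cyclic indices 0, 1, 2 to the glues 1, 2, 3, since 0 is
  the null glue.\<close>

definition row_tile :: "nat \<Rightarrow> nat \<Rightarrow> tile" where
  "row_tile i j = (4, Suc j, 0, Suc i)"

text \<open>The appended tile leads to the glue at which a doubled line would end, so both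
  operations yield the same end glues and later stages need not distinguish them.\<close>

fun row_tiles :: "(nat \<Rightarrow> bool) \<Rightarrow> nat \<Rightarrow> nat \<Rightarrow> tile list" where
  "row_tiles op 0 i = [row_tile i (succ 0 i)]"
| "row_tiles op (Suc s) i = row_tiles op s i @
     (if op s then row_tiles op s (succ s i) else [row_tile (succ s i) (succ (Suc s) i)])"

lemma length_row_tiles: "length (row_tiles op s i) = line_length op s"
  by (induction s arbitrary: i) auto

lemma row_row_tile: "i < 3 \<Longrightarrow> j < 3 \<Longrightarrow> row (Suc i) (Suc j) [row_tile i j]"
  by (auto simp: row_def row_tile_def north_def east_def south_def west_def)

lemma row_row_tiles: "i < 3 \<Longrightarrow> row (Suc i) (Suc (succ s i)) (row_tiles op s i)"
proof (induction s arbitrary: i)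
  case 0
  then show ?case by (simp add: row_row_tile)
next
  case (Suc s)
  have "row (Suc (succ s i)) (Suc (succ (Suc s) i))
      (if op s then row_tiles op s (succ s i) else [row_tile (succ s i) (succ (Suc s) i)])"
    using Suc.IH[of "succ s i"] Suc.prems by (simp add: succ_succ row_row_tile)
  from row_append[OF Suc.IH[OF Suc.prems] this] show ?case by simp
qed

definition line_mixin :: "(nat \<Rightarrow> bool) \<Rightarrow> nat \<Rightarrow> nat \<Rightarrow> nat set" where
  "line_mixin op s i = (if s = 0 then {} else insert i (if op (s - 1) then {succ (s - 1) i} else {}))"

definition line_added :: "(nat \<Rightarrow> bool) \<Rightarrow> nat \<Rightarrow> nat \<Rightarrow> tile set" where
  "line_added op s i = (if s = 0 then {row_tile i (succ 0 i)}
     else if op (s - 1) then {} else {row_tile (succ (s - 1) i) (succ s i)})"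

text \<open>Bins 0, 1, 2 build rows and bins 3, 4, 5 build columns during stages 0 to \<open>T\<close>. Then bin 6
  attaches the corner to row 0, then column 3, and finally fills the square. Bin 3 has to keep
  its column for one stage more.\<close>

definition square_system :: "(nat \<Rightarrow> bool) \<Rightarrow> nat \<Rightarrow> staged" where
  "square_system op T = \<lparr>gluefun = strength, temp = 2, stages = T + 4, bins = 7,
     mixin = (\<lambda>s j. if s \<le> T \<and> j < 3 then line_mixin op s j
        else if s \<le> T \<and> j < 6 then (\<lambda>i. i + 3) ` line_mixin op s (j - 3)
        else if s = T + 1 \<and> j = 3 then {3}
        else if s = T + 1 \<and> j = 6 then {0}
        else if s = T + 2 \<and> j = 6 then {3, 6}
        else if s = T + 3 \<and> j = 6 then {6} else {}),
     added = (\<lambda>s j. if s \<le> T \<and> j < 3 then line_added op s j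
        else if s \<le> T \<and> j < 6 then flip_tile ` line_added op s (j - 3)
        else if s = T + 1 \<and> j = 6 then {corner}
        else if s = T + 3 \<and> j = 6 then {filler} else {}),
     outbins = {6}\<rparr>"

lemma square_system_simps [simp]:
  "gluefun (square_system op T) = strength" "temp (square_system op T) = 2"
  "stages (square_system op T) = T + 4" "bins (square_system op T) = 7"
  "outbins (square_system op T) = {6}"
  by (simp_all add: square_system_def)

lemma line_mixin_less: "k \<in> line_mixin op s i \<Longrightarrow> i < 3 \<Longrightarrow> k < 3"
  by (auto simp: line_mixin_def split: if_splits)

lemma well_formed_square_system: "well_formed (square_system op T)"
proof -
  have "k < 7" if "k \<in> line_mixin op s j" "j < 3" for s j k
    using line_mixin_less[OF that] by simp
  moreover have "k + 3 < 7" if "k \<in> line_mixin op s (j - 3)" "j < 6" for s j k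
  proof -
    have "j - 3 < 3" using that(2) by arith
    from line_mixin_less[OF that(1) this] show ?thesis by simp
  qed
  ultimately have "k < 7" if "k \<in> mixin (square_system op T) s j" for s j k
    using that by (auto simp: square_system_def split: if_splits)
  then have "mixin (square_system op T) s j \<subseteq> {..<7}" for s j
    by blast
  moreover have "mixin (square_system op T) 0 j = {}" for j
    by (simp add: square_system_def line_mixin_def)
  ultimately show ?thesis
    by (auto simp: well_formed_def strength.commute) (auto simp: strength_def)
qed

section \<open>Terminal supertiles of each bin at each stage\<close>

lemma terminal_empty: "terminal G \<tau> {} = {}"
proof -
  have "A \<in> produced G \<tau> {} \<Longrightarrow> False" for A
    by (induction rule: produced.induct) auto
  then show ?thesis by (auto simp: terminal_def)
qed

text \<open>An appended tile enters as a line of length 1, so doubling and appending are both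
  instances of \<open>terminal_rows\<close>.\<close>

lemma binterm_rows:
  "s \<le> T \<Longrightarrow> i < 3 \<Longrightarrow> binterm (square_system op T) s i = orbit (line (row_tiles op s i))"
proof (induction s arbitrary: i)
  case 0
  have "added (square_system op T) 0 i = {row_tile i (succ 0 i)}"
    using 0 by (simp add: square_system_def line_added_def)
  then show ?case
    using terminal_row[of "{line (row_tiles op 0 i)}", OF _ _ row_row_tiles[OF 0(2), where s = 0 and op = op]] succ_neq[OF 0(2), of 0]
    by (simp add: single_eq_line)
next
  case (Suc s)
  let ?sys = "square_system op T" and ?j = "succ s i" and ?k = "succ (Suc s) i"
  define ys where "ys = (if op s then row_tiles op s ?j else [row_tile ?j ?k])"
  have IH: "binterm ?sys s l = orbit (line (row_tiles op s l))" if "l < 3" for l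
    using Suc that by simp
  have ys: "row (Suc ?j) (Suc ?k) ys"
    using row_row_tiles[of ?j s op] Suc.prems by (simp add: ys_def row_row_tile succ_succ)
  have neq: "i \<noteq> ?j" "?j \<noteq> ?k" "i \<noteq> ?k"
    using succ_neq[of i s] succ_neq[of ?j s] succ_neq[of i "Suc s"] succ_succ[of i s] Suc.prems by auto
  let ?S = "(\<Union>k \<in> mixin ?sys (Suc s) i \<inter> {..<7}. binterm ?sys s k) \<union> single ` added ?sys (Suc s) i"
  have bins: "i \<in> {..<7}" "?j \<in> {..<7}" using Suc.prems less_trans[OF succ_less, of 7] by simp_all
  \<comment> \<open>Doubling pours in a whole orbit, whereas an added tile is present in one
    position only; \<open>terminal_rows\<close> accepts either, as meeting the orbit is
    enough.\<close>
  have S: "?S = orbit (line (row_tiles op s i)) \<union> (if op s then orbit (line ys) else {line ys})"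
    using Suc.prems bins IH[of i] IH[of ?j]
    by (auto simp: square_system_def line_mixin_def line_added_def ys_def single_eq_line)
  have "terminal strength 2 ?S = orbit (line (row_tiles op s i @ ys))"
    unfolding S
    by (rule terminal_rows[OF _ _ _ row_row_tiles[OF Suc.prems(2), where s = s and op = op] ys])
      (use neq in auto)
  then show ?case by (simp add: ys_def)
qed

text \<open>Bin \<open>i + 3\<close> receives the reflections of what bin \<open>i\<close> receives,
  so \<open>terminal_flip\<close> replaces a second analysis.\<close>

lemma binterm_columns:
  "s \<le> T \<Longrightarrow> i < 3 \<Longrightarrow> binterm (square_system op T) s (i + 3) = flip ` binterm (square_system op T) s i"
proof (induction s arbitrary: i)
  case 0
  let ?sys = "square_system op T"
  have "added ?sys 0 (i + 3) = flip_tile ` added ?sys 0 i"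
    using 0 by (simp add: square_system_def)
  then have "single ` added ?sys 0 (i + 3) = flip ` single ` added ?sys 0 i"
    by (simp add: image_image flip_single)
  then show ?case by (simp add: terminal_flip)
next
  case (Suc s)
  let ?sys = "square_system op T"
  have "added ?sys (Suc s) (i + 3) = flip_tile ` added ?sys (Suc s) i"
    using Suc.prems by (simp add: square_system_def)
  then have a: "single ` added ?sys (Suc s) (i + 3) = flip ` single ` added ?sys (Suc s) i"
    by (simp add: image_image flip_single)
  have m: "mixin ?sys (Suc s) i = line_mixin op (Suc s) i"
    "mixin ?sys (Suc s) (i + 3) = (\<lambda>i. i + 3) ` line_mixin op (Suc s) i"
    using Suc.prems by (simp_all add: square_system_def)
  have less: "k < 3" if "k \<in> line_mixin op (Suc s) i" for k
    using line_mixin_less[OF that Suc.prems(2)] .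
  have "(\<Union>k \<in> mixin ?sys (Suc s) (i + 3) \<inter> {..<7}. binterm ?sys s k)
      = (\<Union>k \<in> line_mixin op (Suc s) i. binterm ?sys s (k + 3))"
    unfolding m using less by fastforce
  also have "\<dots> = (\<Union>k \<in> line_mixin op (Suc s) i. flip ` binterm ?sys s k)"
    using Suc less by simp
  also have "\<dots> = flip ` (\<Union>k \<in> mixin ?sys (Suc s) i \<inter> {..<7}. binterm ?sys s k)"
    unfolding m image_UN using less by fastforce
  finally show ?case
    by (simp add: a terminal_flip flip: image_Un)
qed

lemma binterm_final:
  fixes op T
  defines "sys \<equiv> square_system op T" and "ts \<equiv> row_tiles op T 0"
  shows "binterm sys (T + 1) 6 = orbit (line (corner # ts))"
    and "binterm sys (T + 1) 3 = orbit (flip (line ts))"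
    and "binterm sys (T + 2) 6 = orbit (frame ts)"
    and "binterm sys (T + 3) 6 = orbit (filled ts (inner ts))"
proof -
  have row: "row 1 (Suc (succ T 0)) ts" "Suc (succ T 0) \<noteq> 1"
    using row_row_tiles[of 0 T op] succ_neq[of 0 T] by (auto simp: ts_def)
  have base: "binterm sys T 0 = orbit (line ts)" "binterm sys T 3 = orbit (flip (line ts))"
    using binterm_rows[of T T 0 op] binterm_columns[of T T 0 op] by (simp_all add: sys_def ts_def orbit_flip)
  have "terminal strength 2 (orbit (line ts) \<union> {line [corner]}) = orbit (line (corner # ts))"
    using row orbit_self by (intro terminal_corner_row) blast+
  moreover have "mixin sys (Suc T) 6 = {0}" "added sys (Suc T) 6 = {corner}"
    by (simp_all add: sys_def square_system_def)
  ultimately show 1: "binterm sys (T + 1) 6 = orbit (line (corner # ts))"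
    using base by (simp add: sys_def single_eq_line)
  \<comment> \<open>The column waits one stage while the row gets its corner; its unequal end glues
    leave it unchanged.\<close>
  have "terminal strength 2 (orbit (line ts)) = orbit (line ts)"
    using row orbit_self by (intro terminal_row) (blast | simp)+
  then have "terminal strength 2 (orbit (flip (line ts))) = orbit (flip (line ts))"
    by (simp add: orbit_flip terminal_flip)
  moreover have "mixin sys (Suc T) 3 = {3}" "added sys (Suc T) 3 = {}"
    by (simp_all add: sys_def square_system_def)
  ultimately show 2: "binterm sys (T + 1) 3 = orbit (flip (line ts))"
    using base by (simp add: sys_def)
  have "terminal strength 2 (orbit (flip (line ts)) \<union> orbit (line (corner # ts))) = orbit (frame ts)"
    using row orbit_self by (intro terminal_frame) blast+
  moreover have "mixin sys (Suc (Suc T)) 6 = {3, 6}" "added sys (Suc (Suc T)) 6 = {}"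
    by (simp_all add: sys_def square_system_def)
  ultimately show 3: "binterm sys (T + 2) 6 = orbit (frame ts)"
    using 1 2 by (simp add: sys_def)
  have "terminal strength 2 (orbit (frame ts) \<union> {single filler}) = orbit (filled ts (inner ts))"
    using row orbit_self by (intro terminal_filled) blast+
  moreover have "mixin sys (Suc (Suc (Suc T))) 6 = {6}" "added sys (Suc (Suc (Suc T))) 6 = {filler}"
    by (simp_all add: sys_def square_system_def)
  ultimately show "binterm sys (T + 3) 6 = orbit (filled ts (inner ts))"
    using 3 by (simp add: sys_def numeral_3_eq_3)
qed

text \<open>Uniqueness is demanded of all seven bins at every stage, so bins that receive nothing
  have to be covered as well.\<close>

lemma binterm_unused:
  assumes "\<not> (s \<le> T \<and> j < 6 \<or> s = T + 1 \<and> j \<in> {3, 6} \<or> (s = T + 2 \<or> s = T + 3) \<and> j = 6)"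
  shows "binterm (square_system op T) s j = {}"
proof -
  have "mixin (square_system op T) s j = {}" "added (square_system op T) s j = {}"
    using assms by (auto simp: square_system_def)
  then show ?thesis by (cases s) (simp_all add: terminal_empty)
qed

lemma unique_terminal:
  "\<exists>A. binterm (square_system op T) s j \<subseteq> orbit A"
proof (cases "s \<le> T \<and> j < 6 \<or> s = T + 1 \<and> j \<in> {3, 6} \<or> (s = T + 2 \<or> s = T + 3) \<and> j = 6")
  case True
  then consider "s \<le> T" "j < 3" | "s \<le> T" "j - 3 < 3" "j = j - 3 + 3" | "s = T + 1" "j = 3"
    | "s = T + 1" "j = 6" | "s = T + 2" "j = 6" | "s = T + 3" "j = 6"
    by fastforce
  then show ?thesis
  proof cases
    case 1
    then show ?thesis using binterm_rows by blast
  next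
    case 2
    then have "binterm (square_system op T) s j = orbit (flip (line (row_tiles op s (j - 3))))"
      using binterm_columns[of s T "j - 3" op] binterm_rows[of s T "j - 3" op] by (simp add: orbit_flip)
    then show ?thesis by blast
  qed (use binterm_final[where op = op and T = T] in blast)+
next
  case False
  from binterm_unused[OF this] show ?thesis by blast
qed

lemma uniquely_assembles_square:
  "uniquely_assembles (square_system op T) (square (line_length op T + 1))"
proof -
  let ?sys = "square_system op T" and ?ts = "row_tiles op T 0"
  let ?F = "filled ?ts (inner ?ts)"
  have out: "out_supertiles ?sys = orbit ?F"
    using binterm_final(4)[of op T] by (simp add: out_supertiles_def add.commute)
  have "dom ?F = shifted (0, 0) (square (line_length op T + 1))"
    using dom_filled[of ?ts] unfolding length_row_tiles by (simp add: shifted_def)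
  then have "\<exists>S\<in>out_supertiles ?sys. (\<forall>B\<in>out_supertiles ?sys. \<exists>v. B = translate v S) \<and>
      (\<exists>v. dom S = shifted v (square (line_length op T + 1)))"
    unfolding out using orbit_self[of ?F] orbit_related by blast
  moreover have "\<exists>v. B = translate v A" if "A \<in> binterm ?sys s j" "B \<in> binterm ?sys s j" for A B s j
    using that unique_terminal[of op T s j] orbit_related by blast
  ultimately show ?thesis unfolding uniquely_assembles_def by blast
qed

lemma fully_connected_square:
  assumes "S \<in> out_supertiles (square_system op T)"
  shows "fully_connected strength S"
proof -
  let ?ts = "row_tiles op T 0"
  have "S \<in> orbit (filled ?ts (inner ?ts))"
    using assms binterm_final(4)[of op T] by (simp add: out_supertiles_def add.commute)
  then show ?thesis
    using fully_connected_translate[OF fully_connected_filled] row_row_tiles[of 0 T op]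
    by (auto simp: orbit_def)
qed

section \<open>Counting tile types and glues\<close>

definition row_tile_list :: "tile list" where
  "row_tile_list = [row_tile 0 1, row_tile 0 2, row_tile 1 0, row_tile 1 2, row_tile 2 0, row_tile 2 1]"

text \<open>Corner, filler, one row tile for each of the six ordered pairs of distinct strong glues,
  and six reflections: 14 in total.\<close>

definition tile_list :: "tile list" where
  "tile_list = corner # filler # row_tile_list @ map flip_tile row_tile_list"

lemma row_tile_in_list: "i < 3 \<Longrightarrow> j < 3 \<Longrightarrow> i \<noteq> j \<Longrightarrow> row_tile i j \<in> set row_tile_list"
  by (auto simp: row_tile_list_def dest!: less_3_cases)

text \<open>\<open>succ\<close> never fixes an index, so a tile added at any stage joins two
  different strong glues.\<close>

lemma line_added_subset: "i < 3 \<Longrightarrow> line_added op s i \<subseteq> set row_tile_list"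
proof (cases s)
  case 0
  assume "i < 3"
  then have "row_tile i (succ 0 i) \<in> set row_tile_list"
    using succ_neq[of i 0] by (intro row_tile_in_list) simp_all
  then show ?thesis using 0 by (simp add: line_added_def)
next
  case (Suc r)
  assume "i < 3"
  then have "row_tile (succ r i) (succ s i) \<in> set row_tile_list"
    using succ_neq[of "succ r i" r] unfolding Suc succ_succ[OF \<open>i < 3\<close>, symmetric]
    by (intro row_tile_in_list) simp_all
  then show ?thesis using Suc by (simp add: line_added_def)
qed

lemma tile_types_subset: "tile_types (square_system op T) \<subseteq> set tile_list"
proof -
  have set: "set tile_list = {corner, filler} \<union> set row_tile_list \<union> flip_tile ` set row_tile_list"
    by (auto simp: tile_list_def)
  have "line_added op s j \<subseteq> set tile_list" if "j < 3" for s j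
    using line_added_subset[OF that] unfolding set by blast
  moreover have "flip_tile ` line_added op s (j - 3) \<subseteq> set tile_list" if "j < 6" for s j
  proof -
    have "j - 3 < 3" using that by arith
    from line_added_subset[OF this] show ?thesis unfolding set by blast
  qed
  moreover have "corner \<in> set tile_list" "filler \<in> set tile_list" by (simp_all add: set)
  ultimately have "added (square_system op T) s j \<subseteq> set tile_list" for s j
    by (simp add: square_system_def)
  then show ?thesis by (auto simp: tile_types_def)
qed

lemma glues_used_subset:
  assumes "tile_types sys \<subseteq> set tile_list"
  shows "glues_used sys \<subseteq> {1, 2, 3, 4}"
proof -
  have *: "{north t, east t, south t, west t} \<subseteq> {0, 1, 2, 3, 4}" if "t \<in> set tile_list" for t
    using that by (auto simp: tile_list_def row_tile_list_def corner_def filler_def row_tile_def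
        flip_tile_def north_def east_def south_def west_def)
  show ?thesis
  proof
    fix g assume "g \<in> glues_used sys"
    then obtain t where t: "g \<noteq> 0" "t \<in> tile_types sys" "g \<in> {north t, east t, south t, west t}"
      unfolding glues_used_def by blast
    have "t \<in> set tile_list" using t(2) assms by (rule rev_subsetD)
    from subsetD[OF *[OF this] t(3)] t(1) show "g \<in> {1, 2, 3, 4}" by simp
  qed
qed

theorem theorem1:
  shows "\<exists>c::real. \<forall>n::nat. n \<ge> 1 \<longrightarrow>
    (\<exists>sys. well_formed sys \<and> temp sys = 2 \<and>
       uniquely_assembles sys (square n) \<and>
       (\<forall>S \<in> out_supertiles sys. fully_connected (gluefun sys) S) \<and>
       real (stages sys) \<le> c * (1 + log 2 (real n)) \<and>
       card (glues_used sys) \<le> 4 \<and>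
       finite (tile_types sys) \<and> card (tile_types sys) \<le> 14 \<and>
       bins sys \<le> 7)"
\<comment> \<open>The constant comes from \<open>T + 4\<close> stages with \<open>T\<close> at most
  twice the binary logarithm of \<open>n - 1\<close>.\<close>
proof (intro exI[of _ 4] allI impI)
  fix n :: nat assume n: "n \<ge> 1"
  let ?Q = "\<lambda>sys. well_formed sys \<and> temp sys = 2 \<and>
       uniquely_assembles sys (square n) \<and>
       (\<forall>S \<in> out_supertiles sys. fully_connected (gluefun sys) S) \<and>
       real (stages sys) \<le> 4 * (1 + log 2 (real n)) \<and>
       card (glues_used sys) \<le> 4 \<and>
       finite (tile_types sys) \<and> card (tile_types sys) \<le> 14 \<and>
       bins sys \<le> 7"
  have counts: "card (glues_used sys) \<le> 4 \<and> finite (tile_types sys) \<and> card (tile_types sys) \<le> 14"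
    if "tile_types sys \<subseteq> set tile_list" for sys
  proof (intro conjI)
    have "card (glues_used sys) \<le> card {1, 2, 3, 4::nat}"
      using glues_used_subset[OF that] by (intro card_mono) auto
    then show "card (glues_used sys) \<le> 4" by simp
    show "finite (tile_types sys)" using that finite_subset by blast
    have "card (tile_types sys) \<le> card (set tile_list)" using that by (intro card_mono) auto
    also have "\<dots> \<le> length tile_list" by (rule card_length)
    finally show "card (tile_types sys) \<le> 14" by (simp add: tile_list_def row_tile_list_def)
  qed
  show "\<exists>sys. ?Q sys"
  \<comment> \<open>For \<open>n = 1\<close> the line of length \<open>n - 1\<close> would be empty;
    a single corner tile is already the square.\<close>
  proof (cases "n = 1")
    case True
    define sys where "sys = \<lparr>gluefun = strength, temp = 2, stages = 1, bins = 1,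
      mixin = (\<lambda>_ _. {}), added = (\<lambda>_ _. {corner}), outbins = {0}\<rparr>"
    have "terminal strength 2 {line [corner]} = orbit (line [corner])"
      by (rule strength.terminal_single) (simp_all add: lines_not_attach)
    then have tm: "binterm sys 0 j = orbit (line [corner])" for j
      by (simp add: sys_def single_eq_line)
    then have out: "out_supertiles sys = orbit (line [corner])"
      by (simp add: out_supertiles_def sys_def)
    have "line [corner] p = None \<longleftrightarrow> p \<notin> square n" for p
      by (cases p) (auto simp: True line_apply square_def)
    then have "dom (line [corner]) = shifted (0, 0) (square n)"
      by (simp add: set_eq_iff domIff shifted_def)
    then have "\<exists>S\<in>out_supertiles sys. (\<forall>B\<in>out_supertiles sys. \<exists>v. B = translate v S) \<and>
        (\<exists>v. dom S = shifted v (square n))"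
      unfolding out using orbit_self[of "line [corner]"] orbit_related by blast
    then have "uniquely_assembles sys (square n)"
      unfolding uniquely_assembles_def using tm orbit_related[of _ "line [corner]"]
      by (auto simp: sys_def)
    moreover have "fully_connected strength (line [corner])"
      by (auto simp: fully_connected_def line_Some)
    then have "\<forall>S\<in>out_supertiles sys. fully_connected strength S"
      unfolding out orbit_def using fully_connected_translate by blast
    moreover have "tile_types sys \<subseteq> set tile_list"
      by (auto simp: tile_types_def sys_def tile_list_def)
    moreover have "well_formed sys"
      by (auto simp: well_formed_def sys_def strength_def)
    moreover have "gluefun sys = strength" "temp sys = 2" "stages sys = 1" "bins sys = 1"
      by (simp_all add: sys_def)
    ultimately have "?Q sys" using counts[of sys] True by simp
    then show ?thesis ..
  next
    case False
    with n have "n - 1 \<ge> 1" by simp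
    then obtain op T where T: "line_length op T = n - 1" "real T \<le> 2 * log 2 (real (n - 1))"
      using line_length_surj by blast
    have "log 2 (real (n - 1)) \<le> log 2 (real n)" "0 \<le> log 2 (real n)"
      using False n by (simp_all add: log_le_cancel_iff)
    then have "real (T + 4) \<le> 4 * (1 + log 2 (real n))" using T(2) by simp
    moreover have "uniquely_assembles (square_system op T) (square n)"
      using uniquely_assembles_square[of op T] T(1) n by simp
    ultimately have "?Q (square_system op T)"
      using well_formed_square_system[of op T] fully_connected_square[of _ op T]
        counts[OF tile_types_subset[of op T]] by simp
    then show ?thesis ..
  qed
qed

end
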